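(* Let $N$ be a positive squarefree integer with $-N \equiv 1 \bmod 4$. For each integer $n \ge 1$ let $r_{2,N}(n)$ denote the number of pairs $(x,y) \in \mathbb{Z}^2$ with $x^2 + N y^2 = n$. Then, as $x \to \infty$, $$\sum_{n \le x} r_{2,N}(n)^2 \sim \frac{3}{N} \Big( \prod_{p \mid 2N} \frac{2p}{p+1} \Big)\, x \log x,$$ where the sum is over positive integers $n \le x$ and the product is over all primes $p$ dividing $2N$.
   Context: Solutions are counted with signs and order, i.e. $r_{2,N}(n) = \#\{(x,y) \in \mathbb{Z}^2 : x^2 + N y^2 = n\}$. The notation $f(x) \sim g(x)$ means $f(x)/g(x) \to 1$ as $x \to \infty$, with $N$ fixed. *)

theory Defs
  imports "HOL-Analysis.Analysis" "HOL-Number_Theory.Number_Theory"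
    "HOL-Computational_Algebra.Squarefree" "HOL-Library.Landau_Symbols"
begin

(* For N > 0 the set below is finite, so card is the true number of representations. *)
definition r2 :: "nat \<Rightarrow> nat \<Rightarrow> nat" where
  "r2 N n = card {(x :: int, y :: int). x\<^sup>2 + int N * y\<^sup>2 = int n}"

end

theory Submission
  imports Defs "HOL-Real_Asymp.Real_Asymp"
begin

text \<open>The sum counts solutions of $x^2 + N y^2 = z^2 + N w^2 \le X$. With $a = x - z$, $b = x + z$,
  $c = w - y$, $d = w + y$ the equation becomes $ab = Ncd$. As $N$ is squarefree, its nonzero solutions
  are $(a, b, c, d) = (g u k, h v l, v k, u l)$ with $N = gh$, $\gcd(gu, hv) = 1$ and $(k, l) \ne 0$, each
  arising from exactly two parameter tuples, and the height condition turns into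
  $(g u^2 + h v^2)(g k^2 + h l^2) \le 4X$. So everything reduces to the hyperbola-type count of pairs of
  lattice points $(u, v)$, $(k, l)$ for which the product of the values of the form $g s^2 + h t^2$ is
  bounded. If the two families have $\sim \alpha n$ and $\sim \beta n$ points of value at most $n$,
  that count is $\sim \alpha \beta n \log n$. The constant $\alpha$ comes from the area of an ellipse and
  from removing the common factors of $u$ and $v$, all of which are prime to $2N$.\<close>

section \<open>Densities of sets of integers\<close>

text \<open>The parametrization is lopsided: |k| = gcd(a, c) and |l| = gcd(b, d) absorb the common
  factors, so \<open>(u, v)\<close> carries all coprimality and \<open>(k, l)\<close> need only be
  nonzero. Hence only the first family needs a sieve. The congruence makes \<open>N\<close>, and
  with it \<open>g\<close> and \<open>h\<close>, odd; the integrality of x, y, z, w then depends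
  only on the parities of u, v, k, l, which leaves four classes.

  Let Z be the sum of 1 / e^2 over e prime to 2N. In each class alpha = pi phi(N) / (4 N sqrt(N) Z)
  and beta = pi / (4 sqrt(N)). Four classes and the height 4X give the factor 16, so one
  factorization N = g h contributes pi^2 phi(N) / (N^2 Z), whatever \<open>g\<close> is. Multiplying
  by the 2^omega(N) divisors \<open>g\<close> and halving for the two parameter tuples gives the
  constant.

  Neither class numbers nor Dirichlet series enter. A limit for the density of each family is enough
  for the product count, since errors of order X vanish against X log X.\<close>

definition has_int_density :: "int set \<Rightarrow> real \<Rightarrow> bool" where
  "has_int_density U d \<longleftrightarrow>
     (\<exists>K. \<forall>t\<ge>0. \<bar>real (card {u \<in> U. \<bar>real_of_int u\<bar> \<le> t}) - 2 * d * t\<bar> \<le> K)"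

lemma finite_int_abs_le: "finite {u \<in> U. \<bar>real_of_int u\<bar> \<le> t}"
proof (rule finite_subset)
  show "{u \<in> U. \<bar>real_of_int u\<bar> \<le> t} \<subseteq> {-\<lfloor>t\<rfloor>..\<lfloor>t\<rfloor>}"
  proof
    fix u assume "u \<in> {u \<in> U. \<bar>real_of_int u\<bar> \<le> t}"
    then have "u \<le> \<lfloor>t\<rfloor>" "- u \<le> \<lfloor>t\<rfloor>" by (auto simp: le_floor_iff abs_le_iff)
    then show "u \<in> {-\<lfloor>t\<rfloor>..\<lfloor>t\<rfloor>}" by simp
  qed
qed simp

lemma has_int_density_Un:
  assumes "has_int_density U a" "has_int_density V b" "U \<inter> V = {}"
  shows "has_int_density (U \<union> V) (a + b)"
proof -
  obtain K where K: "\<And>t. t \<ge> 0 \<Longrightarrow> \<bar>real (card {u \<in> U. \<bar>real_of_int u\<bar> \<le> t}) - 2 * a * t\<bar> \<le> K"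
    using assms(1) unfolding has_int_density_def by blast
  obtain L where L: "\<And>t. t \<ge> 0 \<Longrightarrow> \<bar>real (card {u \<in> V. \<bar>real_of_int u\<bar> \<le> t}) - 2 * b * t\<bar> \<le> L"
    using assms(2) unfolding has_int_density_def by blast
  have "\<bar>real (card {u \<in> U \<union> V. \<bar>real_of_int u\<bar> \<le> t}) - 2 * (a + b) * t\<bar> \<le> K + L"
    if t: "t \<ge> 0" for t
  proof -
    let ?A = "{u \<in> U. \<bar>real_of_int u\<bar> \<le> t}" and ?B = "{u \<in> V. \<bar>real_of_int u\<bar> \<le> t}"
    have eq: "{u \<in> U \<union> V. \<bar>real_of_int u\<bar> \<le> t} = ?A \<union> ?B" by blast
    have "card (?A \<union> ?B) = card ?A + card ?B"
      by (rule card_Un_disjoint[OF finite_int_abs_le finite_int_abs_le]) (use assms(3) in blast)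
    then have "real (card {u \<in> U \<union> V. \<bar>real_of_int u\<bar> \<le> t}) = real (card ?A) + real (card ?B)"
      unfolding eq by simp
    then show ?thesis using K[OF t] L[OF t] by (auto simp: abs_le_iff algebra_simps)
  qed
  then show ?thesis unfolding has_int_density_def by blast
qed

lemma has_int_density_Diff:
  assumes "has_int_density U a" "has_int_density V b" "V \<subseteq> U"
  shows "has_int_density (U - V) (a - b)"
proof -
  obtain K where K: "\<And>t. t \<ge> 0 \<Longrightarrow> \<bar>real (card {u \<in> U. \<bar>real_of_int u\<bar> \<le> t}) - 2 * a * t\<bar> \<le> K"
    using assms(1) unfolding has_int_density_def by blast
  obtain L where L: "\<And>t. t \<ge> 0 \<Longrightarrow> \<bar>real (card {u \<in> V. \<bar>real_of_int u\<bar> \<le> t}) - 2 * b * t\<bar> \<le> L"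
    using assms(2) unfolding has_int_density_def by blast
  have "\<bar>real (card {u \<in> U - V. \<bar>real_of_int u\<bar> \<le> t}) - 2 * (a - b) * t\<bar> \<le> K + L"
    if t: "t \<ge> 0" for t
  proof -
    let ?A = "{u \<in> U - V. \<bar>real_of_int u\<bar> \<le> t}" and ?B = "{u \<in> V. \<bar>real_of_int u\<bar> \<le> t}"
    have eq: "{u \<in> U. \<bar>real_of_int u\<bar> \<le> t} = ?A \<union> ?B" using assms(3) by blast
    have "card (?A \<union> ?B) = card ?A + card ?B"
      by (rule card_Un_disjoint[OF finite_int_abs_le finite_int_abs_le]) blast
    then have "real (card {u \<in> U. \<bar>real_of_int u\<bar> \<le> t}) = real (card ?A) + real (card ?B)"
      unfolding eq by simp
    then show ?thesis using K[OF t] L[OF t] by (auto simp: abs_le_iff algebra_simps)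
  qed
  then show ?thesis unfolding has_int_density_def by blast
qed

lemma has_int_density_UN:
  assumes "finite I" "\<And>i. i \<in> I \<Longrightarrow> has_int_density (U i) (a i)" "disjoint_family_on U I"
  shows "has_int_density (\<Union>i\<in>I. U i) (\<Sum>i\<in>I. a i)"
  using assms
proof (induction I rule: finite_induct)
  case empty
  show ?case unfolding has_int_density_def by (intro exI[of _ 0]) simp
next
  case (insert j I)
  have "U j \<inter> (\<Union>i\<in>I. U i) = {}"
  proof (rule equals0I)
    fix x assume "x \<in> U j \<inter> (\<Union>i\<in>I. U i)"
    then obtain i where i: "i \<in> I" "x \<in> U j \<inter> U i" by blast
    then have "j \<noteq> i" using insert.hyps(2) by blast
    then show False
      using disjoint_family_onD[OF insert.prems(2), of j i] i by blast
  qed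
  moreover have "disjoint_family_on U I"
    using insert.prems(2) by (rule disjoint_family_on_mono[rotated]) blast
  then have "has_int_density (\<Union>i\<in>I. U i) (\<Sum>i\<in>I. a i)"
    using insert.IH insert.prems(1) by blast
  ultimately have "has_int_density (U j \<union> (\<Union>i\<in>I. U i)) (a j + (\<Sum>i\<in>I. a i))"
    using insert.prems(1) by (intro has_int_density_Un) blast+
  then show ?case using insert.hyps by simp
qed

lemma has_int_density_double:
  assumes "has_int_density U a"
  shows "has_int_density ((*) 2 ` U) (a / 2)"
proof -
  obtain K where K: "\<And>t. t \<ge> 0 \<Longrightarrow> \<bar>real (card {u \<in> U. \<bar>real_of_int u\<bar> \<le> t}) - 2 * a * t\<bar> \<le> K"
    using assms(1) unfolding has_int_density_def by blast
  have "\<bar>real (card {u \<in> (*) 2 ` U. \<bar>real_of_int u\<bar> \<le> t}) - 2 * (a / 2) * t\<bar> \<le> K"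
    if t: "t \<ge> 0" for t
  proof -
    have "{u \<in> (*) 2 ` U. \<bar>real_of_int u\<bar> \<le> t} = (*) 2 ` {u \<in> U. \<bar>real_of_int u\<bar> \<le> t / 2}"
      by (auto simp: abs_mult)
    then have "card {u \<in> (*) 2 ` U. \<bar>real_of_int u\<bar> \<le> t} = card {u \<in> U. \<bar>real_of_int u\<bar> \<le> t / 2}"
      by (simp add: card_image inj_on_def)
    then show ?thesis using K[of "t / 2"] t by simp
  qed
  then show ?thesis unfolding has_int_density_def by blast
qed

text \<open>Members of the progression in [-t, t] correspond to the integers in an interval of
  length 2 t / m. Rounding its two ends gives an error bounded independently of t.\<close>

lemma has_int_density_residue:
  fixes m r :: int
  assumes "m > 0" "0 \<le> r" "r < m"
  shows "has_int_density {u. u mod m = r} (1 / of_int m)"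
proof -
  have "\<bar>real (card {u \<in> {u. u mod m = r}. \<bar>real_of_int u\<bar> \<le> t}) - 2 * (1 / of_int m) * t\<bar> \<le> 2"
    if t: "t \<ge> 0" for t
  proof -
    let ?a = "\<lceil>(- t - of_int r) / of_int m\<rceil>" and ?b = "\<lfloor>(t - of_int r) / of_int m\<rfloor>"
    have 1: "\<bar>of_int r + of_int m * real_of_int i\<bar> \<le> t \<longleftrightarrow> ?a \<le> i \<and> i \<le> ?b" for i
    proof -
      have m: "real_of_int m > 0" using assms(1) by simp
      have "?a \<le> i \<longleftrightarrow> - t - of_int r \<le> of_int m * of_int i"
        using m by (simp add: ceiling_le_iff pos_divide_le_eq mult.commute)
      moreover have "i \<le> ?b \<longleftrightarrow> of_int m * of_int i \<le> t - of_int r"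
        using m by (simp add: le_floor_iff pos_le_divide_eq mult.commute)
      ultimately show ?thesis by linarith
    qed
    have "{u \<in> {u. u mod m = r}. \<bar>real_of_int u\<bar> \<le> t} = (\<lambda>i. r + m * i) ` {?a..?b}" (is "?L = ?R")
    proof
      show "?R \<subseteq> ?L"
      proof
        fix u assume "u \<in> ?R"
        then obtain i where i: "?a \<le> i \<and> i \<le> ?b" "u = r + m * i" by auto
        have "u mod m = r" unfolding i(2) using assms by simp
        moreover have "\<bar>real_of_int u\<bar> \<le> t" unfolding i(2) using 1[of i] i(1) by simp
        ultimately show "u \<in> ?L" by blast
      qed
      show "?L \<subseteq> ?R"
      proof
        fix u assume u: "u \<in> ?L"
        then have e: "u = r + m * (u div m)" by (metis (mono_tags) mem_Collect_eq mod_mult_div_eq)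
        then have "\<bar>of_int r + of_int m * real_of_int (u div m)\<bar> \<le> t"
          using u by (metis (mono_tags) mem_Collect_eq of_int_add of_int_mult)
        then have "u div m \<in> {?a..?b}" using 1[of "u div m"] by simp
        then show "u \<in> ?R" using e by (rule_tac image_eqI)
      qed
    qed
    then have c: "card {u \<in> {u. u mod m = r}. \<bar>real_of_int u\<bar> \<le> t} = nat (?b - ?a + 1)"
      using assms(1) by (simp add: card_image inj_on_def)
    have "(- t - of_int r) / of_int m \<le> (t - of_int r) / of_int m"
      using assms(1) t by (simp add: divide_simps)
    \<comment> \<open>An interval that contains no integer still has floor at least ceiling minus 1,
      so \<open>nat\<close> truncates nothing.\<close>
    then have "?b - ?a + 1 \<ge> 0" by linarith
    then have "real (nat (?b - ?a + 1)) = of_int ?b - of_int ?a + 1" by simp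
    moreover have "(t - of_int r) / of_int m - (- t - of_int r) / of_int m = 2 * (1 / of_int m) * t"
      using assms(1) by (simp add: field_simps)
    ultimately show ?thesis unfolding c by linarith
  qed
  then show ?thesis unfolding has_int_density_def by blast
qed

section \<open>Integers prime to a modulus, split by parity\<close>

lemma card_coprime_residues:
  assumes "h > 0"
  shows "card {r \<in> {0..<int h}. coprime r (int h)} = totient h"
proof (cases "h = 1")
  \<comment> \<open>\<open>totatives\<close> lives in 1..h, the residues in 0..h-1. They differ only
    at h = 1, where the residue 0 replaces the totative 1.\<close>
  case True
  have "{r \<in> {0..<int h}. coprime r (int h)} = {0}"
    unfolding True by auto
  then show ?thesis unfolding True by simp
next
  case False
  have "{r \<in> {0..<int h}. coprime r (int h)} = int ` totatives h" (is "?L = ?R")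
  proof (intro equalityI subsetI)
    fix r assume r: "r \<in> ?L"
    then have "coprime r (int h)" by blast
    then have "r \<noteq> 0" using False by auto
    moreover obtain k where k: "r = int k" using r nonneg_int_cases[of r] by auto
    ultimately have "k \<in> totatives h" using r unfolding k by (simp add: totatives_def)
    then show "r \<in> ?R" unfolding k by (rule imageI)
  next
    fix r assume "r \<in> ?R"
    then obtain k where k: "r = int k" "k \<in> totatives h" by blast
    have "k < h" by (rule totatives_less[OF k(2)]) (use False assms in linarith)
    then show "r \<in> ?L" using k(2) unfolding k(1) by (simp add: totatives_def)
  qed
  then show ?thesis by (simp add: card_image totient_def)
qed

lemma has_int_density_coprime:
  assumes "h > 0"
  shows "has_int_density {u. coprime u (int h)} (real (totient h) / real h)"
proof -
  let ?I = "{r \<in> {0..<int h}. coprime r (int h)}"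
  have "has_int_density (\<Union>r\<in>?I. {u. u mod int h = r}) (\<Sum>r\<in>?I. 1 / of_int (int h))"
  proof (intro has_int_density_UN has_int_density_residue)
    show "finite ?I" by (rule finite_subset[of _ "{0..<int h}"]) auto
  qed (use assms in \<open>auto simp: disjoint_family_on_def\<close>)
  moreover have "(\<Union>r\<in>?I. {u. u mod int h = r}) = {u. coprime u (int h)}" (is "?L = ?R")
  proof (intro equalityI subsetI)
    fix u assume "u \<in> ?L"
    then show "u \<in> ?R" by auto
  next
    fix u assume "u \<in> ?R"
    then have "u mod int h \<in> ?I" using assms by simp
    then show "u \<in> ?L" by blast
  qed
  moreover have "(\<Sum>r\<in>?I. 1 / real_of_int (int h)) = real (totient h) / real h"
    unfolding sum_constant card_coprime_residues[OF assms] by simp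
  ultimately show ?thesis by (simp only:)
qed

text \<open>The flag \<open>b\<close> is \<open>True\<close> for the even elements.\<close>

definition coprime_with_parity :: "nat \<Rightarrow> bool \<Rightarrow> int set" where
  "coprime_with_parity h b = {u. coprime u (int h) \<and> (even u \<longleftrightarrow> b)}"

text \<open>As \<open>h\<close> is odd, doubling maps the integers prime to \<open>h\<close> onto
  the even ones among them. These take half of the density, and the odd ones are the
  complement.\<close>

lemma has_int_density_coprime_with_parity:
  assumes "odd h"
  shows "has_int_density (coprime_with_parity h b) (real (totient h) / real h / 2)"
proof -
  have h: "h > 0" using assms by (cases h) auto
  let ?C = "{u. coprime u (int h)}"
  have e: "coprime_with_parity h True = (*) 2 ` ?C"
  proof (intro equalityI subsetI)
    fix u assume "u \<in> coprime_with_parity h True"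
    then have "even u" "coprime u (int h)" by (simp_all add: coprime_with_parity_def)
    then have "u = 2 * (u div 2)" "coprime (u div 2) (int h)"
      by (auto intro: coprime_divisors[OF _ dvd_refl, of "u div 2" u])
    then show "u \<in> (*) 2 ` ?C" by blast
  next
    fix u assume "u \<in> (*) 2 ` ?C"
    then show "u \<in> coprime_with_parity h True"
      using assms by (auto simp: coprime_with_parity_def)
  qed
  have d: "has_int_density (coprime_with_parity h True) (real (totient h) / real h / 2)"
    unfolding e by (intro has_int_density_double has_int_density_coprime h)
  have "coprime_with_parity h False = ?C - coprime_with_parity h True"
    by (auto simp: coprime_with_parity_def)
  moreover have "coprime_with_parity h True \<subseteq> ?C"
    by (auto simp: coprime_with_parity_def)
  ultimately have "has_int_density (coprime_with_parity h False)
      (real (totient h) / real h - real (totient h) / real h / 2)"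
    using has_int_density_Diff[OF has_int_density_coprime[OF h] d] by simp
  with d show ?thesis by (cases b) (simp_all add: mult.commute)
qed

section \<open>Lattice points in an ellipse\<close>

text \<open>The antiderivative is continuous on [0, 1], but arcsin is not differentiable at 1, hence
  the interior form of the fundamental theorem.\<close>

lemma has_integral_quarter_circle: "((\<lambda>t. sqrt (1 - t\<^sup>2)) has_integral pi / 4) {0..1}"
proof -
  let ?F = "\<lambda>t. (t * sqrt (1 - t\<^sup>2) + arcsin t) / 2"
  have "((\<lambda>t. sqrt (1 - t\<^sup>2)) has_integral ?F 1 - ?F 0) {0..1}"
  proof (rule fundamental_theorem_of_calculus_interior)
    show "continuous_on {0..1} ?F"
      by (intro continuous_intros continuous_on_subset[OF continuous_on_arcsin']) auto
    fix t :: real assume t: "t \<in> {0<..<1}"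
    then have "t * t < 1 * 1" by (intro mult_strict_mono) auto
    then have p: "1 - t\<^sup>2 > 0" by (simp add: power2_eq_square)
    have q: "sqrt (1 - t\<^sup>2) * sqrt (1 - t\<^sup>2) = 1 - t\<^sup>2" using p by simp
    have "(?F has_real_derivative
        (1 * sqrt (1 - t\<^sup>2) + (- (2 * t)) / (2 * sqrt (1 - t\<^sup>2)) * t + inverse (sqrt (1 - t\<^sup>2))) / 2) (at t)"
      using t p by (auto intro!: derivative_eq_intros simp: field_simps)
    also have "(1 * sqrt (1 - t\<^sup>2) + (- (2 * t)) / (2 * sqrt (1 - t\<^sup>2)) * t + inverse (sqrt (1 - t\<^sup>2))) / 2
        = sqrt (1 - t\<^sup>2)"
      using p q by (simp add: field_simps power2_eq_square)
    finally show "(?F has_vector_derivative sqrt (1 - t\<^sup>2)) (at t)"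
      by (simp add: has_real_derivative_iff_has_vector_derivative)
  qed simp
  then show ?thesis by simp
qed

lemma has_integral_quarter_ellipse:
  fixes g h R :: real
  assumes "g > 0" "h > 0" "R > 0"
  shows "((\<lambda>y. sqrt ((R - h * y\<^sup>2) / g)) has_integral pi * R / (4 * sqrt (g * h))) {0..sqrt (R / h)}"
proof -
  let ?m = "sqrt (h / R)"
  have m: "?m > 0" using assms by simp
  have "((\<lambda>y. sqrt (R / g) * sqrt (1 - (?m * y)\<^sup>2)) has_integral
      sqrt (R / g) * ((1 / \<bar>?m\<bar>) *\<^sub>R (pi / 4))) ((\<lambda>y. y / ?m) ` {0..1})"
    using assms by (intro has_integral_mult_right has_integral_stretch_real has_integral_quarter_circle) simp
  moreover have "(\<lambda>y. y / ?m) ` {0..1} = {0..sqrt (R / h)}"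
    using m assms image_divide_atLeastAtMost[of ?m 0 1] by (simp add: real_sqrt_divide)
  moreover have "(\<lambda>y. sqrt (R / g) * sqrt (1 - (?m * y)\<^sup>2)) = (\<lambda>y. sqrt ((R - h * y\<^sup>2) / g))"
    using assms by (intro ext) (simp flip: real_sqrt_mult add: power_mult_distrib field_simps)
  moreover have "sqrt (R / g) * ((1 / \<bar>?m\<bar>) *\<^sub>R (pi / 4)) = pi * R / (4 * sqrt (g * h))"
    using assms by (simp add: real_sqrt_divide real_sqrt_mult field_simps)
  ultimately show ?thesis by (simp only:)
qed

lemma abs_le_sqrt_iff: "c \<ge> 0 \<Longrightarrow> \<bar>v\<bar> \<le> sqrt c \<longleftrightarrow> v\<^sup>2 \<le> c" for v c :: real
  by (metis real_sqrt_abs real_sqrt_le_iff)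

text \<open>The bounded error in \<open>has_int_density\<close> is used twice. Counting column by
  column costs O(1) for each of O(sqrt R) columns; replacing the sum of column heights by an
  integral costs O(1) at each height y, over a range of length O(sqrt R). The main term is 2b times
  2a times a quarter of the ellipse's area.\<close>

lemma lattice_points_ellipse:
  fixes g h :: real
  assumes gh: "g > 0" "h > 0" and U: "has_int_density U a" and V: "has_int_density V b"
  shows "\<exists>K. \<forall>R\<ge>1. \<bar>real (card {(u, v). u \<in> U \<and> v \<in> V \<and> g * (of_int u)\<^sup>2 + h * (of_int v)\<^sup>2 \<le> R})
           - a * b * pi * R / sqrt (g * h)\<bar> \<le> K * sqrt R"
proof -
  obtain K where K: "\<And>t. t \<ge> 0 \<Longrightarrow> \<bar>real (card {u \<in> U. \<bar>real_of_int u\<bar> \<le> t}) - 2 * a * t\<bar> \<le> K"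
    using U unfolding has_int_density_def by blast
  obtain L where L: "\<And>t. t \<ge> 0 \<Longrightarrow> \<bar>real (card {v \<in> V. \<bar>real_of_int v\<bar> \<le> t}) - 2 * b * t\<bar> \<le> L"
    using V unfolding has_int_density_def by blast
  have K0: "K \<ge> 0" and L0: "L \<ge> 0" using K[of 0] L[of 0] by linarith+
  let ?C = "L * (2 * \<bar>a\<bar> / sqrt g + K) + 2 * \<bar>b\<bar> * (K / sqrt h)"
  have "\<bar>real (card {(u, v). u \<in> U \<and> v \<in> V \<and> g * (of_int u)\<^sup>2 + h * (of_int v)\<^sup>2 \<le> R})
           - a * b * pi * R / sqrt (g * h)\<bar> \<le> ?C * sqrt R" if R: "R \<ge> 1" for R
  proof -
    \<comment> \<open>\<open>X\<close> and \<open>Y\<close> are the semi-axes, \<open>s u\<close> is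
      the half-height of the column at \<open>u\<close>, and \<open>r y\<close> the half-width of
      the row at height \<open>y\<close>.\<close>
    define X Y where "X = sqrt (R / g)" and "Y = sqrt (R / h)"
    have XY: "X \<ge> 0" "Y \<ge> 0" using R gh by (simp_all add: X_def Y_def)
    define s where "s u = sqrt ((R - g * (of_int u)\<^sup>2) / h)" for u :: int
    define r where "r y = sqrt ((R - h * y\<^sup>2) / g)" for y
    define UX where "UX = {u \<in> U. \<bar>real_of_int u\<bar> \<le> X}"
    have fin: "finite UX" unfolding UX_def by (rule finite_int_abs_le)
    have X_iff: "\<bar>x\<bar> \<le> X \<longleftrightarrow> g * x\<^sup>2 \<le> R" for x
      unfolding X_def using gh R by (subst abs_le_sqrt_iff) (auto simp: field_simps)
    have Y_iff: "\<bar>y\<bar> \<le> Y \<longleftrightarrow> h * y\<^sup>2 \<le> R" for y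
      unfolding Y_def using gh R by (subst abs_le_sqrt_iff) (auto simp: field_simps)
    have s_iff: "\<bar>y\<bar> \<le> s u \<longleftrightarrow> g * (of_int u)\<^sup>2 + h * y\<^sup>2 \<le> R" if "\<bar>real_of_int u\<bar> \<le> X" for u y
      unfolding s_def using gh that[unfolded X_iff] by (subst abs_le_sqrt_iff) (auto simp: field_simps)
    have r_iff: "\<bar>x\<bar> \<le> r y \<longleftrightarrow> g * x\<^sup>2 + h * y\<^sup>2 \<le> R" if "\<bar>y\<bar> \<le> Y" for x y
      unfolding r_def using gh that[unfolded Y_iff] by (subst abs_le_sqrt_iff) (auto simp: field_simps)
    have s0: "s u \<ge> 0" if "u \<in> UX" for u
      unfolding s_def using that gh X_iff[of u] by (auto simp: UX_def)
    have r0: "r y \<ge> 0" if "y \<in> {0..Y}" for y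
      unfolding r_def using that gh Y_iff[of y] by auto
    have sY: "s u \<le> Y" for u
      unfolding s_def Y_def using gh by (intro real_sqrt_le_mono divide_right_mono) auto

    have "{(u, v). u \<in> U \<and> v \<in> V \<and> g * (of_int u)\<^sup>2 + h * (of_int v)\<^sup>2 \<le> R}
        = Sigma UX (\<lambda>u. {v \<in> V. \<bar>real_of_int v\<bar> \<le> s u})" (is "?A = ?B")
    proof (intro equalityI subsetI)
      fix z assume z: "z \<in> ?A"
      then obtain u v where uv: "z = (u, v)" "u \<in> U" "v \<in> V" "g * (of_int u)\<^sup>2 + h * (of_int v)\<^sup>2 \<le> R"
        by blast
      have "h * (real_of_int v)\<^sup>2 \<ge> 0" using gh by simp
      then have "\<bar>real_of_int u\<bar> \<le> X" unfolding X_iff using uv(4) by linarith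
      then show "z \<in> ?B" using uv s_iff[of u v] by (simp add: UX_def)
    next
      fix z assume "z \<in> ?B"
      then obtain u v where uv: "z = (u, v)" "u \<in> U" "\<bar>real_of_int u\<bar> \<le> X" "v \<in> V" "\<bar>real_of_int v\<bar> \<le> s u"
        by (auto simp: UX_def)
      then show "z \<in> ?A" using s_iff[of u v] by simp
    qed
    then have "real (card ?A) = (\<Sum>u\<in>UX. real (card {v \<in> V. \<bar>real_of_int v\<bar> \<le> s u}))"
      using fin finite_int_abs_le by simp
    then have "real (card ?A) - 2 * b * (\<Sum>u\<in>UX. s u)
        = (\<Sum>u\<in>UX. real (card {v \<in> V. \<bar>real_of_int v\<bar> \<le> s u}) - 2 * b * s u)"
      by (simp add: sum_subtractf sum_distrib_left)
    then have 1: "\<bar>real (card ?A) - 2 * b * (\<Sum>u\<in>UX. s u)\<bar> \<le> real (card UX) * L"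
      using sum_norm_bound[of UX "\<lambda>u. real (card {v \<in> V. \<bar>real_of_int v\<bar> \<le> s u}) - 2 * b * s u" L]
        L[OF s0] by simp

    \<comment> \<open>Writing \<open>s u\<close> as the integral of an indicator function and exchanging sum and integral
      turns the sum over \<open>u\<close> into a one-dimensional count in \<open>U\<close>.\<close>
    have "((\<lambda>y. if y \<le> s u then 1 else 0) has_integral s u) {0..Y}" if "u \<in> UX" for u
    proof -
      have "((\<lambda>y. if y \<in> {0..s u} then 1 else 0) has_integral s u) {0..Y}"
        using has_integral_const_real[of "1::real" 0 "s u"] s0[OF that] sY[of u]
        by (subst has_integral_restrict) auto
      then show ?thesis
        by (rule has_integral_eq[rotated]) auto
    qed
    then have "((\<lambda>y. \<Sum>u\<in>UX. if y \<le> s u then 1 else 0) has_integral (\<Sum>u\<in>UX. s u)) {0..Y}"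
      by (intro has_integral_sum fin)
    moreover have "(\<Sum>u\<in>UX. if y \<le> s u then 1 else 0) = real (card {u \<in> U. \<bar>real_of_int u\<bar> \<le> r y})"
      if y: "y \<in> {0..Y}" for y
    proof -
      have "{u \<in> U. \<bar>real_of_int u\<bar> \<le> r y} = {u \<in> UX. y \<le> s u}"
      proof (intro equalityI subsetI)
        fix u assume u: "u \<in> {u \<in> U. \<bar>real_of_int u\<bar> \<le> r y}"
        then have 2: "g * (of_int u)\<^sup>2 + h * y\<^sup>2 \<le> R" using r_iff[of y u] y by simp
        have "h * y\<^sup>2 \<ge> 0" using gh by simp
        then have "\<bar>real_of_int u\<bar> \<le> X" unfolding X_iff using 2 by linarith
        then show "u \<in> {u \<in> UX. y \<le> s u}" using u 2 s_iff[of u y] y by (simp add: UX_def)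
      next
        fix u assume u: "u \<in> {u \<in> UX. y \<le> s u}"
        then show "u \<in> {u \<in> U. \<bar>real_of_int u\<bar> \<le> r y}"
          using s_iff[of u y] r_iff[of y u] y by (simp add: UX_def)
      qed
      then show ?thesis using fin by (simp add: sum.If_cases Int_def)
    qed
    ultimately have I1: "((\<lambda>y. real (card {u \<in> U. \<bar>real_of_int u\<bar> \<le> r y})) has_integral (\<Sum>u\<in>UX. s u)) {0..Y}"
      by (rule has_integral_eq[rotated]) auto
    have I2: "((\<lambda>y. 2 * a * r y) has_integral 2 * a * (pi * R / (4 * sqrt (g * h)))) {0..Y}"
      unfolding r_def Y_def using gh R by (intro has_integral_mult_right has_integral_quarter_ellipse) auto
    \<comment> \<open>For each y the number of u in the row differs from 2 a r(y) by at most
      \<open>K\<close>. Integrating over [0, Y] multiplies this error by \<open>Y\<close>.\<close>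
    have "norm ((\<Sum>u\<in>UX. s u) - 2 * a * (pi * R / (4 * sqrt (g * h)))) \<le> K * measure lborel {0..Y}"
      by (rule has_integral_bound_real[OF K0 finite.emptyI has_integral_diff[OF I1 I2]])
         (use K r0 in \<open>simp add: real_norm_def\<close>)
    then have "\<bar>(\<Sum>u\<in>UX. s u) - 2 * a * (pi * R / (4 * sqrt (g * h)))\<bar> \<le> K * Y"
      unfolding real_norm_def content_real[OF XY(2)] by simp
    then have 2: "2 * \<bar>b\<bar> * \<bar>(\<Sum>u\<in>UX. s u) - 2 * a * (pi * R / (4 * sqrt (g * h)))\<bar> \<le> 2 * \<bar>b\<bar> * (K * Y)"
      by (intro mult_left_mono) auto
    have "2 * b * (\<Sum>u\<in>UX. s u) - a * b * pi * R / sqrt (g * h)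
        = (2 * b) * ((\<Sum>u\<in>UX. s u) - 2 * a * (pi * R / (4 * sqrt (g * h))))"
      by (simp add: algebra_simps)
    then have "\<bar>2 * b * (\<Sum>u\<in>UX. s u) - a * b * pi * R / sqrt (g * h)\<bar>
        = 2 * \<bar>b\<bar> * \<bar>(\<Sum>u\<in>UX. s u) - 2 * a * (pi * R / (4 * sqrt (g * h)))\<bar>"
      by (simp only: abs_mult abs_numeral)
    with 2 have 3: "\<bar>2 * b * (\<Sum>u\<in>UX. s u) - a * b * pi * R / sqrt (g * h)\<bar> \<le> 2 * \<bar>b\<bar> * (K * Y)"
      by simp
    have R1: "1 \<le> sqrt R" using R by simp
    have "a * X \<le> \<bar>a\<bar> * X" using XY(1) by (intro mult_right_mono) auto
    then have "real (card UX) \<le> 2 * \<bar>a\<bar> * X + K" using K[OF XY(1)] unfolding UX_def by linarith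
    also have "\<dots> \<le> 2 * \<bar>a\<bar> / sqrt g * sqrt R + K * sqrt R"
      using mult_left_mono[OF R1 K0] by (simp add: X_def real_sqrt_divide)
    finally have "real (card UX) * L \<le> (2 * \<bar>a\<bar> / sqrt g * sqrt R + K * sqrt R) * L"
      using L0 by (rule mult_right_mono)
    moreover have "2 * \<bar>b\<bar> * (K * Y) = 2 * \<bar>b\<bar> * (K / sqrt h) * sqrt R"
      by (simp add: Y_def real_sqrt_divide)
    ultimately show ?thesis using 1 3 by (simp add: algebra_simps)
  qed
  then show ?thesis by blast
qed

lemma lattice_points_ellipse_tendsto:
  fixes g h :: real
  assumes "g > 0" "h > 0" "has_int_density U a" "has_int_density V b"
  shows "((\<lambda>R. real (card {(u, v). u \<in> U \<and> v \<in> V \<and> g * (of_int u)\<^sup>2 + h * (of_int v)\<^sup>2 \<le> R}) / R)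
           \<longlongrightarrow> a * b * pi / sqrt (g * h)) at_top"
proof -
  let ?c = "\<lambda>R. real (card {(u, v). u \<in> U \<and> v \<in> V \<and> g * (of_int u)\<^sup>2 + h * (of_int v)\<^sup>2 \<le> R})"
  obtain K where K: "\<And>R. R \<ge> 1 \<Longrightarrow> \<bar>?c R - a * b * pi * R / sqrt (g * h)\<bar> \<le> K * sqrt R"
    using lattice_points_ellipse[OF assms] by blast
  have "((\<lambda>R. ?c R / R - a * b * pi / sqrt (g * h)) \<longlongrightarrow> 0) at_top"
  proof (rule Lim_null_comparison)
    show "\<forall>\<^sub>F R in at_top. norm (?c R / R - a * b * pi / sqrt (g * h)) \<le> K / sqrt R"
      using eventually_ge_at_top[of "1::real"]
    proof eventually_elim
      case (elim R)
      have "?c R / R - a * b * pi / sqrt (g * h) = (?c R - a * b * pi * R / sqrt (g * h)) / R"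
        using elim by (simp add: field_simps)
      then have "norm (?c R / R - a * b * pi / sqrt (g * h)) = \<bar>?c R - a * b * pi * R / sqrt (g * h)\<bar> / R"
        using elim by simp
      also have "\<dots> \<le> K * sqrt R / R" using elim by (intro divide_right_mono K) auto
      also have "\<dots> = K / sqrt R" using elim real_div_sqrt[of R] by (simp add: field_simps)
      finally show ?case .
    qed
    have "filterlim sqrt at_top (at_top :: real filter)" by (rule sqrt_at_top)
    then show "((\<lambda>R. K / sqrt R) \<longlongrightarrow> 0) at_top"
      by (rule real_tendsto_divide_at_top[OF tendsto_const])
  qed
  then show ?thesis by (simp add: LIM_zero_iff)
qed

section \<open>Counting pairs with bounded product\<close>

text \<open>\<open>K\<close> may depend on \<open>e\<close>: with \<open>e\<close> fixed the
  \<open>q\<close> term dies in the limit, and only then does \<open>e\<close> shrink. Both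
  asymptotic counts below have errors of this shape.\<close>

lemma tendsto_0_by_epsilon:
  fixes x p q :: "'a \<Rightarrow> real"
  assumes p: "(p \<longlongrightarrow> P) F" and q: "(q \<longlongrightarrow> 0) F"
    and bound: "\<And>e. e > 0 \<Longrightarrow> \<exists>K. \<forall>\<^sub>F n in F. \<bar>x n\<bar> \<le> e * p n + K * q n"
  shows "(x \<longlongrightarrow> 0) F"
proof (rule tendstoI)
  fix e :: real assume e: "e > 0"
  define d where "d = e / (2 * (\<bar>P\<bar> + 1))"
  have d: "d > 0" "d * (\<bar>P\<bar> + 1) = e / 2" using e by (auto simp: d_def field_simps)
  obtain K where K: "\<forall>\<^sub>F n in F. \<bar>x n\<bar> \<le> d * p n + K * q n" using bound[OF d(1)] by blast
  have "\<forall>\<^sub>F n in F. p n < \<bar>P\<bar> + 1" using p by (rule order_tendstoD) linarith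
  moreover have "((\<lambda>n. K * q n) \<longlongrightarrow> 0) F" using tendsto_mult_left[OF q, of K] by simp
  then have "\<forall>\<^sub>F n in F. K * q n < e / 2" by (rule order_tendstoD) (use e in simp)
  ultimately show "\<forall>\<^sub>F n in F. dist (x n) 0 < e"
    using K
  proof eventually_elim
    case (elim n)
    have "d * p n \<le> d * (\<bar>P\<bar> + 1)" using elim(1) d(1) by (intro mult_left_mono) auto
    then show ?case using elim d(2) by simp
  qed
qed

text \<open>The additive \<open>K\<close> absorbs the finitely many small n, so the bound holds for
  every n. This matters because it is later applied at all quotients n div f z, including small
  ones.\<close>

lemma linear_error_bound:
  fixes c :: "nat \<Rightarrow> real"
  assumes "(\<lambda>n. c n / real n) \<longlonglongrightarrow> b" "e > 0"
  shows "\<exists>K\<ge>0. \<forall>n. \<bar>c n - b * real n\<bar> \<le> e * real n + K"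
proof -
  have "\<forall>\<^sub>F n in sequentially. dist (c n / real n) b < e" using assms by (rule tendstoD)
  then obtain n0 where n0: "\<And>n. n \<ge> n0 \<Longrightarrow> dist (c n / real n) b < e"
    unfolding eventually_sequentially by blast
  define K where "K = (\<Sum>n\<le>n0. \<bar>c n - b * real n\<bar>)"
  have K: "K \<ge> 0" by (simp add: K_def sum_nonneg)
  have "\<bar>c n - b * real n\<bar> \<le> e * real n + K" for n
  proof (cases "n \<le> n0")
    case True
    then have "\<bar>c n - b * real n\<bar> \<le> K"
      unfolding K_def by (intro member_le_sum[of n _ "\<lambda>n. \<bar>c n - b * real n\<bar>"]) auto
    moreover have "e * real n \<ge> 0" using assms(2) by simp
    ultimately show ?thesis by linarith
  next
    case False
    then have "\<bar>c n / real n - b\<bar> < e" using n0[of n] by (simp add: dist_real_def)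
    then have "real n * \<bar>c n / real n - b\<bar> \<le> real n * e" by (intro mult_left_mono) auto
    moreover have "real n * \<bar>c n / real n - b\<bar> = \<bar>c n - b * real n\<bar>"
      using False abs_mult[of "real n" "c n / real n - b"] by (simp add: field_simps)
    ultimately show ?thesis using K by (simp add: mult.commute)
  qed
  with K show ?thesis by blast
qed

lemma harm_over_ln_tendsto: "(\<lambda>n. harm n / ln (real n)) \<longlonglongrightarrow> 1"
proof -
  have inf: "filterlim (\<lambda>n. ln (real n)) at_top sequentially"
    by (rule filterlim_compose[OF ln_at_top filterlim_real_sequentially])
  have "(\<lambda>n. (harm n - ln (real n)) / ln (real n) + 1) \<longlonglongrightarrow> 0 + 1"
    by (intro tendsto_add tendsto_const real_tendsto_divide_at_top[OF euler_mascheroni_LIMSEQ inf])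
  moreover have "\<forall>\<^sub>F n in sequentially. (harm n - ln (real n)) / ln (real n) + 1 = harm n / ln (real n)"
    using eventually_ge_at_top[of "2::nat"] by eventually_elim (auto simp: field_simps)
  ultimately show ?thesis by (simp add: tendsto_cong)
qed

text \<open>Partial summation: for a counting function \<open>c\<close> this is the sum of the reciprocals of the
  counted values up to \<open>n\<close>. It is linear and monotone in \<open>c\<close>, so an error \<open>e k + K\<close> in \<open>c k\<close> costs
  only \<open>e\<close> times a harmonic number plus \<open>K\<close>.\<close>

definition abel_mean :: "(nat \<Rightarrow> real) \<Rightarrow> nat \<Rightarrow> real" where
  "abel_mean c n = (\<Sum>k=1..n. c k / (real k * (real k + 1))) + c n / (real n + 1)"

text \<open>The weights come from 1 / k - 1 / (k + 1) = 1 / (k (k + 1)). The boundary term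
  telescopes, and only the newly counted elements remain, each with weight 1 / (n + 1).\<close>

lemma abel_mean_Suc:
  "abel_mean c (Suc n) = abel_mean c n + (c (Suc n) - c n) / real (Suc n)"
proof -
  have *: "x / ((r + 1) * (r + 2)) + x / (r + 2) = x / (r + 1)" if "r \<ge> 0" for x r :: real
  proof -
    have "r + 1 \<noteq> 0" "r + 2 \<noteq> 0" using that by auto
    then show ?thesis by (simp add: divide_simps) (simp add: algebra_simps)
  qed
  show ?thesis using *[of "real n" "c (Suc n)"]
    by (simp add: abel_mean_def diff_divide_distrib add_ac)
qed

lemma abel_mean_linear: "abel_mean (\<lambda>k. a * f k + b * g k) n = a * abel_mean f n + b * abel_mean g n"
  by (simp add: abel_mean_def sum.distrib sum_distrib_left add_divide_distrib algebra_simps)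

lemma abel_mean_abs_le:
  assumes "\<And>k. \<bar>f k\<bar> \<le> g k"
  shows "\<bar>abel_mean f n\<bar> \<le> abel_mean g n"
proof -
  have "\<bar>abel_mean f n\<bar> \<le> (\<Sum>k=1..n. \<bar>f k / (real k * (real k + 1))\<bar>) + \<bar>f n / (real n + 1)\<bar>"
    unfolding abel_mean_def by (intro order_trans[OF abs_triangle_ineq] add_mono sum_abs) auto
  also have "\<dots> \<le> abel_mean g n"
    unfolding abel_mean_def using assms
    by (intro add_mono sum_mono) (auto simp: abs_mult intro!: divide_right_mono)
  finally show ?thesis .
qed

lemma abel_mean_id: "abel_mean real n = harm n"
proof (induction n)
  case 0
  show ?case by (simp add: abel_mean_def harm_def)
next
  case (Suc n)
  then show ?case by (simp add: abel_mean_Suc harm_Suc inverse_eq_divide)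
qed

lemma abel_mean_1: "abel_mean (\<lambda>_. 1) n = 1"
  by (induction n) (simp add: abel_mean_def, simp add: abel_mean_Suc)

text \<open>The reciprocal sum is \<open>abel_mean\<close> of the counting function. A count of
  exactly a k would give a times the harmonic number, and a deviation of e k + K changes this by at
  most e times the harmonic number plus K, which is negligible after division by ln n and letting e
  tend to 0.\<close>

lemma sum_reciprocals_asymp:
  fixes f :: "'a \<Rightarrow> nat"
  assumes fin: "\<And>n. finite {z \<in> A. f z \<le> n}" and pos: "\<And>z. z \<in> A \<Longrightarrow> f z > 0"
    and lim: "(\<lambda>n. real (card {z \<in> A. f z \<le> n}) / real n) \<longlonglongrightarrow> a"
  shows "(\<lambda>n. (\<Sum>z\<in>{z \<in> A. f z \<le> n}. 1 / real (f z)) / ln (real n)) \<longlonglongrightarrow> a"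
proof -
  let ?c = "\<lambda>n. real (card {z \<in> A. f z \<le> n})" and ?S = "\<lambda>n. \<Sum>z\<in>{z \<in> A. f z \<le> n}. 1 / real (f z)"
  have S: "?S n = abel_mean ?c n" for n
  proof (induction n)
    case 0
    have "{z \<in> A. f z \<le> 0} = {}" using pos by fastforce
    then show ?case by (simp only: abel_mean_def sum.empty card.empty) simp
  next
    case (Suc n)
    let ?E = "{z \<in> A. f z = Suc n}"
    have E: "{z \<in> A. f z \<le> Suc n} = {z \<in> A. f z \<le> n} \<union> ?E" by auto
    have finE: "finite ?E" by (rule finite_subset[OF _ fin[of "Suc n"]]) auto
    have disj: "{z \<in> A. f z \<le> n} \<inter> ?E = {}" by auto
    have 1: "?S (Suc n) = ?S n + (\<Sum>z\<in>?E. 1 / real (f z))"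
      unfolding E by (rule sum.union_disjoint[OF fin finE disj])
    have "(\<Sum>z\<in>?E. 1 / real (f z)) = (\<Sum>z\<in>?E. 1 / real (Suc n))"
      by (intro sum.cong refl) simp
    also have "\<dots> = real (card ?E) / real (Suc n)" by (simp only: sum_constant) simp
    finally have 2: "(\<Sum>z\<in>?E. 1 / real (f z)) = real (card ?E) / real (Suc n)" .
    have "card {z \<in> A. f z \<le> Suc n} = card {z \<in> A. f z \<le> n} + card ?E"
      unfolding E by (rule card_Un_disjoint[OF fin finE disj])
    then have 3: "?c (Suc n) - ?c n = real (card ?E)" by linarith
    show ?case by (simp only: abel_mean_Suc 1 2 3 Suc.IH)
  qed
  have inf: "filterlim (\<lambda>n. ln (real n)) at_top sequentially"
    by (rule filterlim_compose[OF ln_at_top filterlim_real_sequentially])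
  have "(\<lambda>n. ?S n / ln (real n) - a * (harm n / ln (real n))) \<longlonglongrightarrow> 0"
  proof (rule tendsto_0_by_epsilon[OF harm_over_ln_tendsto])
    show "(\<lambda>n. 1 / ln (real n)) \<longlonglongrightarrow> 0" by (rule real_tendsto_divide_at_top[OF tendsto_const inf])
    fix e :: real assume e: "e > 0"
    obtain K where "\<forall>n. \<bar>?c n - a * real n\<bar> \<le> e * real n + K"
      using linear_error_bound[OF lim e] by (elim exE conjE)
    then have K: "\<And>n. \<bar>?c n - a * real n\<bar> \<le> e * real n + K" by (rule spec)
    have "\<bar>?S n / ln (real n) - a * (harm n / ln (real n))\<bar> \<le> e * (harm n / ln (real n)) + K * (1 / ln (real n))"
      if "n \<ge> 2" for n
    proof -
      have "?S n - a * harm n = abel_mean (\<lambda>k. ?c k - a * real k) n"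
        using abel_mean_linear[of 1 ?c "-a" real n] by (simp add: S abel_mean_id)
      also have "\<bar>\<dots>\<bar> \<le> abel_mean (\<lambda>k. e * real k + K) n" by (rule abel_mean_abs_le) (rule K)
      also have "\<dots> = e * harm n + K"
        using abel_mean_linear[of e real K "\<lambda>_. 1" n] by (simp add: abel_mean_id abel_mean_1)
      finally have "\<bar>?S n - a * harm n\<bar> / ln (real n) \<le> (e * harm n + K) / ln (real n)"
        using that by (intro divide_right_mono) auto
      moreover have "\<bar>?S n / ln (real n) - a * (harm n / ln (real n))\<bar> = \<bar>?S n - a * harm n\<bar> / ln (real n)"
        using that by (simp add: diff_divide_distrib[symmetric] abs_divide)
      ultimately show ?thesis by (simp add: add_divide_distrib)
    qed
    then show "\<exists>K. \<forall>\<^sub>F n in sequentially. \<bar>?S n / ln (real n) - a * (harm n / ln (real n))\<bar>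
        \<le> e * (harm n / ln (real n)) + K * (1 / ln (real n))"
      unfolding eventually_sequentially by blast
  qed
  from tendsto_add[OF this tendsto_mult_left[OF harm_over_ln_tendsto, of a]] show ?thesis by simp
qed

text \<open>For fixed z the admissible w number about b n / f z, so the total is b n times the
  reciprocal sum over \<open>A\<close>, that is about a b n ln n. The errors proportional to n / f z
  carry the factor e, and the constant errors occur once for each of the O(n) elements z, which is
  o(n ln n).\<close>

lemma product_count_asymp:
  fixes f :: "'a \<Rightarrow> nat" and g :: "'b \<Rightarrow> nat"
  assumes finA: "\<And>n. finite {z \<in> A. f z \<le> n}" and posA: "\<And>z. z \<in> A \<Longrightarrow> f z > 0"
    and limA: "(\<lambda>n. real (card {z \<in> A. f z \<le> n}) / real n) \<longlonglongrightarrow> a"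
    and finB: "\<And>n. finite {w \<in> B. g w \<le> n}" and posB: "\<And>w. w \<in> B \<Longrightarrow> g w > 0"
    and limB: "(\<lambda>n. real (card {w \<in> B. g w \<le> n}) / real n) \<longlonglongrightarrow> b"
  shows "(\<lambda>n. real (card {(z, w). z \<in> A \<and> w \<in> B \<and> f z * g w \<le> n}) / (real n * ln (real n))) \<longlonglongrightarrow> a * b"
proof -
  let ?T = "\<lambda>n. real (card {(z, w). z \<in> A \<and> w \<in> B \<and> f z * g w \<le> n})"
  let ?A = "\<lambda>n. {z \<in> A. f z \<le> n}" and ?c = "\<lambda>n. real (card {w \<in> B. g w \<le> n})"
  let ?S = "\<lambda>n. \<Sum>z\<in>?A n. 1 / real (f z)"
  have T: "?T n = (\<Sum>z\<in>?A n. ?c (n div f z))" for n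
  proof -
    have iff: "f z * g w \<le> n \<longleftrightarrow> g w \<le> n div f z" if "z \<in> A" for z w
      using posA[OF that] by (simp add: less_eq_div_iff_mult_less_eq mult.commute)
    have "{(z, w). z \<in> A \<and> w \<in> B \<and> f z * g w \<le> n} = (SIGMA z:?A n. {w \<in> B. g w \<le> n div f z})"
      (is "?L = ?R")
    proof (intro equalityI subsetI)
      fix p assume "p \<in> ?L"
      then obtain z w where p: "p = (z, w)" "z \<in> A" "w \<in> B" "f z * g w \<le> n" by blast
      have "f z * 1 \<le> f z * g w" using posB[OF p(3)] by (intro mult_left_mono) auto
      with p(4) have "f z \<le> n" by linarith
      then show "p \<in> ?R" using p iff by auto
    next
      fix p assume "p \<in> ?R"
      then show "p \<in> ?L" using iff by auto
    qed
    then show ?thesis using finA finB by simp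
  qed
  have inf: "filterlim (\<lambda>n. ln (real n)) at_top sequentially"
    by (rule filterlim_compose[OF ln_at_top filterlim_real_sequentially])
  note limS = sum_reciprocals_asymp[OF finA posA limA]
  have "(\<lambda>n. ?T n / (real n * ln (real n)) - b * (?S n / ln (real n))) \<longlonglongrightarrow> 0"
  proof (rule tendsto_0_by_epsilon[OF limS])
    show "(\<lambda>n. real (card (?A n)) / real n / ln (real n)) \<longlonglongrightarrow> 0"
      by (rule real_tendsto_divide_at_top[OF limA inf])
    fix e :: real assume e: "e > 0"
    obtain K where "\<forall>n. \<bar>?c n - b * real n\<bar> \<le> e * real n + K"
      using linear_error_bound[OF limB e] by (elim exE conjE)
    then have K: "\<And>n. \<bar>?c n - b * real n\<bar> \<le> e * real n + K" by (rule spec)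
    have "\<bar>?T n / (real n * ln (real n)) - b * (?S n / ln (real n))\<bar>
        \<le> e * (?S n / ln (real n)) + (K + \<bar>b\<bar>) * (real (card (?A n)) / real n / ln (real n))"
      if n: "n \<ge> 2" for n
    proof -
      \<comment> \<open>Replacing n div f z by the real quotient moves the main term by at most |b|,
        which explains the constant K + |b|.\<close>
      have "\<bar>?c (n div f z) - b * real n * (1 / real (f z))\<bar> \<le> e * real n * (1 / real (f z)) + (K + \<bar>b\<bar>)"
        if z: "z \<in> ?A n" for z
      proof -
        let ?q = "real (n div f z)" and ?r = "real n / real (f z)"
        have "\<lfloor>?r\<rfloor> = int (n div f z)" by (simp add: floor_divide_of_nat_eq)
        then have qr: "?q \<le> ?r" "?r - 1 \<le> ?q" by linarith+
        then have "\<bar>b * (?q - ?r)\<bar> \<le> \<bar>b\<bar> * 1" unfolding abs_mult by (intro mult_left_mono) auto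
        moreover have "e * ?q \<le> e * ?r" using qr e by (intro mult_left_mono) auto
        ultimately show ?thesis using K[of "n div f z"] by (simp add: algebra_simps)
      qed
      then have "\<bar>\<Sum>z\<in>?A n. ?c (n div f z) - b * real n * (1 / real (f z))\<bar>
          \<le> (\<Sum>z\<in>?A n. e * real n * (1 / real (f z)) + (K + \<bar>b\<bar>))"
        by (intro order_trans[OF sum_abs] sum_mono)
      then have "\<bar>?T n - b * real n * ?S n\<bar> \<le> e * real n * ?S n + real (card (?A n)) * (K + \<bar>b\<bar>)"
        unfolding T by (simp only: sum_subtractf sum.distrib sum_distrib_left sum_constant distrib_left)
      then have "\<bar>?T n - b * real n * ?S n\<bar> / (real n * ln (real n))
          \<le> (e * real n * ?S n + real (card (?A n)) * (K + \<bar>b\<bar>)) / (real n * ln (real n))"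
        using n by (intro divide_right_mono) auto
      also have "\<dots> = e * (?S n / ln (real n)) + (K + \<bar>b\<bar>) * (real (card (?A n)) / real n / ln (real n))"
        using n by (simp add: add_divide_distrib)
      finally have "\<bar>?T n - b * real n * ?S n\<bar> / (real n * ln (real n))
         \<le> e * (?S n / ln (real n)) + (K + \<bar>b\<bar>) * (real (card (?A n)) / real n / ln (real n))" .
      moreover have "?T n / (real n * ln (real n)) - b * (?S n / ln (real n))
          = (?T n - b * real n * ?S n) / (real n * ln (real n))"
        using n by (simp add: diff_divide_distrib)
      moreover have "\<bar>(?T n - b * real n * ?S n) / (real n * ln (real n))\<bar>
          = \<bar>?T n - b * real n * ?S n\<bar> / (real n * ln (real n))"
        using n by (simp add: abs_divide abs_mult)
      ultimately show ?thesis by (simp only:)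
    qed
    then show "\<exists>K. \<forall>\<^sub>F n in sequentially. \<bar>?T n / (real n * ln (real n)) - b * (?S n / ln (real n))\<bar>
        \<le> e * (?S n / ln (real n)) + K * (real (card (?A n)) / real n / ln (real n))"
      unfolding eventually_sequentially by blast
  qed
  from tendsto_add[OF this tendsto_mult_left[OF limS, of b]] show ?thesis by (simp add: mult.commute)
qed

section \<open>Removing common factors\<close>

text \<open>Inverts \<open>B x = (\<Sum>e. A (x / e\<^sup>2))\<close> without the Moebius function: since the weights other than
  \<open>w 1\<close> have total \<open>z - 1 < 1\<close>, the relation improves any asymptotic bound \<open>c\<close> for the deviation of
  \<open>A x / x\<close> from \<open>b / z\<close> to \<open>c (z - 1)\<close>, so the infimum of these bounds is 0.\<close>

lemma sieve_contraction:
  fixes A B :: "real \<Rightarrow> real" and w :: "nat \<Rightarrow> real"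
  assumes w0: "w 0 = 0" and w1: "w 1 = 1" and w_nonneg: "\<And>e. w e \<ge> 0"
    and w_sums: "w sums z" and z: "z < 2"
    and A_small: "\<And>x. x < 1 \<Longrightarrow> A x = 0" and A_bound: "\<And>x. x > 0 \<Longrightarrow> \<bar>A x\<bar> \<le> C * x"
    and B_eq: "\<And>x M. x > 0 \<Longrightarrow> x \<le> real M \<Longrightarrow>
                 B x / x = (\<Sum>e\<le>M. w e * (A (x / (real e)\<^sup>2) / (x / (real e)\<^sup>2)))"
    and B_lim: "((\<lambda>x. B x / x) \<longlongrightarrow> b) at_top"
  shows "((\<lambda>x. A x / x) \<longlongrightarrow> b / z) at_top"
proof -
  have w1': "w (Suc 0) = 1" using w1 by simp
  have sw: "summable w" and z_eq: "suminf w = z" using w_sums by (auto simp: sums_iff)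
  have "(\<Sum>e\<le>1. w e) \<le> suminf w" using sum_le_suminf[OF sw, of "{..1}"] w_nonneg by simp
  then have z1: "z \<ge> 1" using z_eq w0 w1 by (simp add: numeral_2_eq_2)
  define a where "a = b / z"
  have a: "a * z = b" using z1 by (simp add: a_def)
  define d where "d x = A x / x - a" for x
  define C0 where "C0 = \<bar>C\<bar> + \<bar>a\<bar>"
  have d_bound: "\<bar>d x\<bar> \<le> C0" if "x > 0" for x
  proof -
    have "\<bar>A x / x\<bar> = \<bar>A x\<bar> / x" using that by simp
    also have "\<dots> \<le> C * x / x" using that by (intro divide_right_mono A_bound) auto
    also have "\<dots> = C" using that by simp
    finally show ?thesis unfolding d_def C0_def by linarith
  qed
  have C0: "C0 \<ge> 0" by (simp add: C0_def)
  \<comment> \<open>Solving \<open>B_eq\<close> for the term e = 1, which is d x itself; e = 0 has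
    weight 0.\<close>
  have key: "d x = (B x / x - b) - a * ((\<Sum>e\<le>M. w e) - z) - (\<Sum>e\<in>{2..M}. w e * d (x / (real e)\<^sup>2))"
    if x: "x > 0" "x \<le> real M" and M: "M \<ge> 2" for x M
  proof -
    have "B x / x = (\<Sum>e\<le>M. w e * d (x / (real e)\<^sup>2) + a * w e)"
      unfolding B_eq[OF x] d_def by (intro sum.cong refl) (simp add: algebra_simps)
    also have "\<dots> = (\<Sum>e\<le>M. w e * d (x / (real e)\<^sup>2)) + a * (\<Sum>e\<le>M. w e)"
      by (simp add: sum.distrib sum_distrib_left)
    also have "{..M} = insert 0 (insert 1 {2..M})" using M by auto
    also have "(\<Sum>e\<in>insert 0 (insert 1 {2..M}). w e * d (x / (real e)\<^sup>2)) = d x + (\<Sum>e\<in>{2..M}. w e * d (x / (real e)\<^sup>2))"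
      by (simp add: w0 w1')
    also have "insert 0 (insert 1 {2..M}) = {..M}" using M by auto
    finally show ?thesis using a by (simp add: algebra_simps)
  qed
  have step: "\<exists>x0. \<forall>x\<ge>x0. \<bar>d x\<bar> \<le> c * (z - 1) + \<eta>"
    if c: "c \<ge> 0" "\<forall>x\<ge>x1. \<bar>d x\<bar> \<le> c" and \<eta>: "\<eta> > 0" for c x1 \<eta>
  proof -
    define \<delta> where "\<delta> = \<eta> / (2 + \<bar>a\<bar> + C0)"
    have p: "2 + \<bar>a\<bar> + C0 > 0" using C0 by linarith
    have \<delta>: "\<delta> > 0" "\<delta> + \<bar>a\<bar> * \<delta> + C0 * \<delta> \<le> \<eta>"
    proof -
      show "\<delta> > 0" using \<eta> p by (simp add: \<delta>_def)
      moreover have "\<delta> * (2 + \<bar>a\<bar> + C0) = \<eta>" using p by (simp add: \<delta>_def)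
      ultimately show "\<delta> + \<bar>a\<bar> * \<delta> + C0 * \<delta> \<le> \<eta>" by (simp add: algebra_simps)
    qed
    have "(\<lambda>M. \<Sum>e\<le>M. w e) \<longlonglongrightarrow> z" using w_sums by (simp add: sums_def_le)
    then have "\<forall>\<^sub>F M in sequentially. dist (\<Sum>e\<le>M. w e) z < \<delta>" using \<delta>(1) by (rule tendstoD)
    then obtain K where K: "\<And>M. M \<ge> K \<Longrightarrow> \<bar>(\<Sum>e\<le>M. w e) - z\<bar> < \<delta>"
      unfolding eventually_sequentially dist_real_def by blast
    have "\<forall>\<^sub>F x in at_top. dist (B x / x) b < \<delta>" using B_lim \<delta>(1) by (rule tendstoD)
    then obtain x2 where x2: "\<And>x. x \<ge> x2 \<Longrightarrow> \<bar>B x / x - b\<bar> < \<delta>"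
      unfolding eventually_at_top_linorder dist_real_def by blast
    define K' where "K' = max K 2"
    have K'2: "K' \<ge> 2" "K' \<ge> K" by (auto simp: K'_def)
    \<comment> \<open>The entry |x1| K'^2 keeps x / e^2 beyond \<open>x1\<close> for all e up to
      \<open>K'\<close>, so that the bound \<open>c\<close> applies to these terms.\<close>
    define x0 where "x0 = Max {x2, \<bar>x1\<bar> * (real K')\<^sup>2, real K', 1}"
    have "\<bar>d x\<bar> \<le> c * (z - 1) + \<eta>" if "x \<ge> x0" for x
    proof -
      have x: "x \<ge> x2" "x \<ge> \<bar>x1\<bar> * (real K')\<^sup>2" "x \<ge> real K'" "x \<ge> 1" using that by (auto simp: x0_def)
      define M where "M = nat \<lceil>x\<rceil>"
      have M: "x \<le> real M" "M \<ge> K'" using x unfolding M_def by linarith+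
      have M2: "M \<ge> 2" using M K'2 by linarith
      have split: "{2..M} = {2..K'} \<union> {K'<..M}" "{2..K'} \<inter> {K'<..M} = {}" using M(2) K'2 by auto
      have W: "(\<Sum>e\<in>{2..K'}. w e) \<le> z - 1"
      proof -
        have "(\<Sum>e\<in>{1..K'}. w e) \<le> z"
          using sum_le_suminf[OF sw, of "{1..K'}"] w_nonneg z_eq by simp
        moreover have "{1..K'} = insert 1 {2..K'}" using K'2 by auto
        ultimately show ?thesis by (simp add: w1')
      qed
      \<comment> \<open>For e above \<open>K'\<close> the argument x / e^2 may be small and only the
        crude bound \<open>C0\<close> is available. The weights compensate: being nonnegative with
        partial sums within delta of z, their tail is at most delta for every
        \<open>M\<close>.\<close>
      have tail: "(\<Sum>e\<in>{K'<..M}. w e) \<le> \<delta>"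
      proof -
        have M_eq: "{..M} = {..K'} \<union> {K'<..M}" using M(2) by auto
        have "(\<Sum>e\<le>M. w e) = (\<Sum>e\<le>K'. w e) + (\<Sum>e\<in>{K'<..M}. w e)"
          unfolding M_eq by (rule sum.union_disjoint) auto
        moreover have "(\<Sum>e\<le>M. w e) \<le> z" using sum_le_suminf[OF sw, of "{..M}"] w_nonneg z_eq by simp
        ultimately show ?thesis using K[OF K'2(2)] by linarith
      qed
      have "\<bar>w e * d (x / (real e)\<^sup>2)\<bar> \<le> w e * c" if e: "e \<in> {2..K'}" for e
      proof -
        have "(real e)\<^sup>2 \<le> (real K')\<^sup>2" using e by (intro power_mono) auto
        then have "\<bar>x1\<bar> * (real e)\<^sup>2 \<le> \<bar>x1\<bar> * (real K')\<^sup>2" by (intro mult_left_mono) auto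
        then have "\<bar>x1\<bar> * (real e)\<^sup>2 \<le> x" using x(2) by linarith
        then have "\<bar>x1\<bar> \<le> x / (real e)\<^sup>2" using e by (simp add: pos_le_divide_eq)
        then have "\<bar>d (x / (real e)\<^sup>2)\<bar> \<le> c" using c(2) by auto
        then show ?thesis unfolding abs_mult using w_nonneg[of e] by (simp add: mult_left_mono)
      qed
      then have "\<bar>\<Sum>e\<in>{2..K'}. w e * d (x / (real e)\<^sup>2)\<bar> \<le> (\<Sum>e\<in>{2..K'}. w e * c)"
        by (intro order_trans[OF sum_abs] sum_mono)
      also have "\<dots> = (\<Sum>e\<in>{2..K'}. w e) * c" by (simp add: sum_distrib_right)
      also have "\<dots> \<le> (z - 1) * c" using W c(1) by (rule mult_right_mono)
      finally have s1: "\<bar>\<Sum>e\<in>{2..K'}. w e * d (x / (real e)\<^sup>2)\<bar> \<le> c * (z - 1)" by (simp add: mult.commute)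
      have "\<bar>w e * d (x / (real e)\<^sup>2)\<bar> \<le> w e * C0" if e: "e \<in> {K'<..M}" for e
      proof -
        have "\<bar>d (x / (real e)\<^sup>2)\<bar> \<le> C0" using x(4) e by (intro d_bound) auto
        then show ?thesis unfolding abs_mult using w_nonneg[of e] by (simp add: mult_left_mono)
      qed
      then have "\<bar>\<Sum>e\<in>{K'<..M}. w e * d (x / (real e)\<^sup>2)\<bar> \<le> (\<Sum>e\<in>{K'<..M}. w e * C0)"
        by (intro order_trans[OF sum_abs] sum_mono)
      also have "\<dots> = (\<Sum>e\<in>{K'<..M}. w e) * C0" by (simp add: sum_distrib_right)
      also have "\<dots> \<le> \<delta> * C0" using tail C0 by (rule mult_right_mono)
      finally have s2: "\<bar>\<Sum>e\<in>{K'<..M}. w e * d (x / (real e)\<^sup>2)\<bar> \<le> C0 * \<delta>" by (simp add: mult.commute)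
      have s: "(\<Sum>e\<in>{2..M}. w e * d (x / (real e)\<^sup>2))
          = (\<Sum>e\<in>{2..K'}. w e * d (x / (real e)\<^sup>2)) + (\<Sum>e\<in>{K'<..M}. w e * d (x / (real e)\<^sup>2))"
        unfolding split(1) by (rule sum.union_disjoint) (use split(2) in auto)
      have "\<bar>(\<Sum>e\<le>M. w e) - z\<bar> \<le> \<delta>" using K[of M] M(2) K'2 by linarith
      then have s3: "\<bar>a * ((\<Sum>e\<le>M. w e) - z)\<bar> \<le> \<bar>a\<bar> * \<delta>"
        unfolding abs_mult by (intro mult_left_mono) auto
      have "x > 0" using x(4) by linarith
      from key[OF this M(1) M2] show ?thesis
        using s s1 s2 s3 x2[OF x(1)] \<delta>(2) by linarith
    qed
    then show ?thesis by blast
  qed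
  \<comment> \<open>All eventual bounds for the deviation. Working with the infimum of
    \<open>T\<close> avoids iterating \<open>step\<close> and accumulating its error terms.\<close>
  define T where "T = {c. c \<ge> 0 \<and> (\<exists>x1. \<forall>x\<ge>x1. \<bar>d x\<bar> \<le> c)}"
  have "C0 \<in> T" unfolding T_def using C0 d_bound by (auto intro!: exI[of _ 1])
  then have T_ne: "T \<noteq> {}" by blast
  have T_bdd: "bdd_below T" unfolding T_def by (rule bdd_belowI[of _ 0]) auto
  have Inf_step: "Inf T \<le> c * (z - 1)" if "c \<in> T" for c
  proof (rule field_le_epsilon)
    fix \<eta> :: real assume \<eta>: "\<eta> > 0"
    from that obtain x1 where c: "c \<ge> 0" "\<forall>x\<ge>x1. \<bar>d x\<bar> \<le> c" unfolding T_def by auto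
    have "c * (z - 1) + \<eta> \<ge> 0" using c(1) z1 \<eta> by simp
    then have "c * (z - 1) + \<eta> \<in> T" using step[OF c \<eta>] unfolding T_def by simp
    then show "Inf T \<le> c * (z - 1) + \<eta>" using T_bdd by (rule cInf_lower)
  qed
  have Inf0: "Inf T \<le> 0"
  proof (cases "z = 1")
    case True
    then show ?thesis using Inf_step[OF \<open>C0 \<in> T\<close>] by simp
  next
    case False
    then have z1': "z - 1 > 0" using z1 by simp
    \<comment> \<open>Every c in \<open>T\<close> satisfies Inf T <= c (z - 1), hence Inf T <= (z -
      1) Inf T. Since z < 2, this forces Inf T <= 0.\<close>
    have "Inf T / (z - 1) \<le> Inf T"
      using Inf_step z1' by (intro cInf_greatest[OF T_ne]) (simp add: pos_divide_le_eq)
    then have "Inf T * (2 - z) \<le> 0" using z1' by (simp add: pos_divide_le_eq algebra_simps)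
    then show ?thesis using z by (simp add: mult_le_0_iff)
  qed
  have "(d \<longlongrightarrow> 0) at_top"
  proof (rule tendstoI)
    fix \<epsilon> :: real assume "\<epsilon> > 0"
    then have "Inf T < \<epsilon>" using Inf0 by linarith
    then obtain c where "c \<in> T" "c < \<epsilon>" using cInf_less_iff[OF T_ne T_bdd] by blast
    then obtain x1 where "\<forall>x\<ge>x1. \<bar>d x\<bar> < \<epsilon>" unfolding T_def by fastforce
    then show "\<forall>\<^sub>F x in at_top. dist (d x) 0 < \<epsilon>"
      unfolding eventually_at_top_linorder dist_real_def by auto
  qed
  then show ?thesis unfolding d_def a_def by (simp add: LIM_zero_iff)
qed

section \<open>Inverse squares of the integers free of given primes\<close>

definition coprime_weight :: "nat set \<Rightarrow> nat \<Rightarrow> real" where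
  "coprime_weight P e = (if e > 0 \<and> (\<forall>p\<in>P. \<not> p dvd e) then 1 / (real e)\<^sup>2 else 0)"

lemma coprime_weight_sums:
  assumes "finite P" "\<And>p. p \<in> P \<Longrightarrow> prime p"
  shows "coprime_weight P sums (pi\<^sup>2 / 6 * (\<Prod>p\<in>P. 1 - 1 / (real p)\<^sup>2))"
proof -
  let ?S = "\<lambda>P. {e :: nat. e > 0 \<and> (\<forall>p\<in>P. \<not> p dvd e)}"
  have "((\<lambda>e. 1 / (real e)\<^sup>2) has_sum (pi\<^sup>2 / 6 * (\<Prod>p\<in>P. 1 - 1 / (real p)\<^sup>2))) (?S P)"
    using assms
  proof (induction P rule: finite_induct)
    case empty
    have "((\<lambda>n. 1 / (real n + 1)\<^sup>2) has_sum (pi\<^sup>2 / 6)) UNIV"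
      using inverse_squares_sums by (intro sums_nonneg_imp_has_sum) (auto simp: add.commute)
    then have "((\<lambda>e. 1 / (real e)\<^sup>2) has_sum (pi\<^sup>2 / 6)) (range Suc)"
      by (subst has_sum_reindex) (auto simp: o_def add.commute)
    moreover have "range Suc = ?S {}" by (auto simp: image_iff gr0_conv_Suc)
    ultimately show ?case by simp
  next
    case (insert p P)
    let ?f = "\<lambda>e. 1 / (real e)\<^sup>2" and ?Z = "pi\<^sup>2 / 6 * (\<Prod>p\<in>P. 1 - 1 / (real p)\<^sup>2)"
    have p: "prime p" and P: "\<And>q. q \<in> P \<Longrightarrow> prime q" using insert.prems by auto
    have Z: "(?f has_sum ?Z) (?S P)" using insert.IH P by blast
    have "((\<lambda>e. 1 / (real p)\<^sup>2 * ?f e) has_sum (1 / (real p)\<^sup>2 * ?Z)) (?S P)"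
      using Z by (rule has_sum_cmult_right)
    then have Zp: "(?f has_sum (1 / (real p)\<^sup>2 * ?Z)) ((*) p ` ?S P)"
      using prime_gt_0_nat[OF p] by (subst has_sum_reindex) (auto simp: o_def inj_on_def power_mult_distrib)
    have sub: "(*) p ` ?S P \<subseteq> ?S P"
    proof safe
      fix e assume e: "e > 0" "\<forall>q\<in>P. \<not> q dvd e"
      show "p * e > 0" using e prime_gt_0_nat[OF p] by simp
      fix q assume q: "q \<in> P" "q dvd p * e"
      then have "q dvd p" using P[OF q(1)] e(2) prime_dvd_mult_iff by blast
      then have "q = p" using P[OF q(1)] p primes_dvd_imp_eq by blast
      then show False using q(1) insert.hyps(2) by simp
    qed
    have diff: "?S P - (*) p ` ?S P = ?S (insert p P)"
    proof (intro equalityI subsetI)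
      fix e assume e: "e \<in> ?S P - (*) p ` ?S P"
      have "\<not> p dvd e"
      proof
        assume "p dvd e"
        then obtain k where k: "e = p * k" by (elim dvdE)
        then have "k \<in> ?S P" using e by auto
        then show False using e k by blast
      qed
      then show "e \<in> ?S (insert p P)" using e by auto
    next
      fix e assume "e \<in> ?S (insert p P)"
      then show "e \<in> ?S P - (*) p ` ?S P" by auto
    qed
    have "(?f has_sum (?Z - 1 / (real p)\<^sup>2 * ?Z)) (?S (insert p P))"
      using has_sum_Diff[OF Z Zp sub] unfolding diff .
    then show ?case using insert.hyps by (simp add: algebra_simps)
  qed
  then have "(coprime_weight P has_sum (pi\<^sup>2 / 6 * (\<Prod>p\<in>P. 1 - 1 / (real p)\<^sup>2))) UNIV"
    by (rule has_sum_cong_neutral[THEN iffD1, rotated -1]) (auto simp: coprime_weight_def)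
  then show ?thesis by (rule has_sum_imp_sums)
qed

text \<open>The contraction needs this strict bound. The prime 2 supplies a factor 3/4 and every
  other factor is at most 1, so the limit is at most pi^2 / 8, and pi < 4 suffices.\<close>

lemma coprime_weight_limit_less_2:
  fixes P :: "nat set"
  assumes "finite P" "\<And>p. p \<in> P \<Longrightarrow> prime p" "2 \<in> P"
  shows "pi\<^sup>2 / 6 * (\<Prod>p\<in>P. 1 - 1 / (real p)\<^sup>2) < 2"
proof -
  have "(\<Prod>p\<in>P. 1 - 1 / (real p)\<^sup>2) = (1 - 1 / (real 2)\<^sup>2) * (\<Prod>p\<in>P - {2}. 1 - 1 / (real p)\<^sup>2)"
    using assms by (intro prod.remove)
  also have "\<dots> \<le> (1 - 1 / (real 2)\<^sup>2) * 1"
  proof (intro mult_left_mono prod_le_1)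
    fix p assume "p \<in> P - {2}"
    then have "real p \<ge> 1" using assms(2) prime_ge_1_nat by fastforce
    then have "(real p)\<^sup>2 \<ge> 1" by simp
    then have "1 / (real p)\<^sup>2 \<le> 1 / 1" by (intro divide_left_mono) linarith+
    then show "0 \<le> 1 - 1 / (real p)\<^sup>2 \<and> 1 - 1 / (real p)\<^sup>2 \<le> 1" by simp
  qed simp
  finally have "pi\<^sup>2 / 6 * (\<Prod>p\<in>P. 1 - 1 / (real p)\<^sup>2) \<le> pi\<^sup>2 / 6 * (3 / 4)"
    by (intro mult_left_mono) (auto simp: power2_eq_square)
  moreover have "pi\<^sup>2 < 4\<^sup>2" using pi_less_4 by (intro power_strict_mono) auto
  then have "pi\<^sup>2 < 16" by simp
  ultimately show ?thesis by linarith
qed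

section \<open>Primitive values of a binary form\<close>

text \<open>Note the crossing: \<open>u\<close> is prime to \<open>h\<close> and \<open>v\<close> is prime to \<open>g\<close>. Together with
  \<open>coprime u v\<close> and \<open>coprime g h\<close> this says that \<open>g u\<close> and \<open>h v\<close> are coprime.\<close>

definition parity_pairs :: "nat \<Rightarrow> nat \<Rightarrow> bool \<Rightarrow> bool \<Rightarrow> (int \<times> int) set" where
  "parity_pairs g h b c = coprime_with_parity h b \<times> coprime_with_parity g c"

definition primitive_pairs :: "nat \<Rightarrow> nat \<Rightarrow> bool \<Rightarrow> bool \<Rightarrow> (int \<times> int) set" where
  "primitive_pairs g h b c = {(u, v) \<in> parity_pairs g h b c. coprime u v}"

text \<open>The form is nonnegative, so \<open>nat\<close> loses nothing, and natural values are
  what \<open>product_count_asymp\<close> expects.\<close>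

definition qform :: "nat \<Rightarrow> nat \<Rightarrow> int \<times> int \<Rightarrow> nat" where
  "qform g h = (\<lambda>(u, v). nat (int g * u\<^sup>2 + int h * v\<^sup>2))"

lemma of_nat_qform: "int (qform g h (u, v)) = int g * u\<^sup>2 + int h * v\<^sup>2"
  by (simp add: qform_def)

lemma real_qform: "real (qform g h (u, v)) = real g * (of_int u)\<^sup>2 + real h * (of_int v)\<^sup>2"
proof -
  have "real_of_int (int (qform g h (u, v))) = real g * (of_int u)\<^sup>2 + real h * (of_int v)\<^sup>2"
    unfolding of_nat_qform by simp
  then show ?thesis by simp
qed

lemma qform_pos:
  assumes "g > 0" "h > 0" "z \<noteq> (0, 0)"
  shows "qform g h z > 0"
proof -
  obtain u v where z: "z = (u, v)" by (cases z)
  have "int g * u\<^sup>2 \<ge> 0" "int h * v\<^sup>2 \<ge> 0" by simp_all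
  moreover have "int g * u\<^sup>2 > 0 \<or> int h * v\<^sup>2 > 0" using assms z by auto
  ultimately have "int (qform g h z) > 0" unfolding z of_nat_qform by linarith
  then show ?thesis by simp
qed

lemma finite_qform_le:
  assumes "g > 0" "h > 0"
  shows "finite {z \<in> Z. real (qform g h z) \<le> x}"
proof (rule finite_subset)
  let ?m = "\<lfloor>x\<rfloor>"
  show "{z \<in> Z. real (qform g h z) \<le> x} \<subseteq> {-?m..?m} \<times> {-?m..?m}"
  proof
    fix z assume z: "z \<in> {z \<in> Z. real (qform g h z) \<le> x}"
    obtain u v where uv: "z = (u, v)" by (cases z)
    have "int (qform g h z) \<le> ?m" using z by (simp add: le_floor_iff)
    then have le: "int g * u\<^sup>2 + int h * v\<^sup>2 \<le> ?m" unfolding uv of_nat_qform .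
    have sq: "\<bar>t\<bar> \<le> int k * t\<^sup>2" if "k > 0" for k :: nat and t :: int
    proof -
      have "\<bar>t\<bar> * 1 \<le> \<bar>t\<bar> * \<bar>t\<bar>"
        by (cases "t = 0") (simp, intro mult_left_mono, linarith+)
      also have "\<dots> = 1 * t\<^sup>2" by (simp add: power2_eq_square)
      also have "\<dots> \<le> int k * t\<^sup>2" using that by (intro mult_right_mono) auto
      finally show ?thesis by simp
    qed
    have "int g * u\<^sup>2 \<ge> 0" "int h * v\<^sup>2 \<ge> 0" by simp_all
    with le sq[OF assms(1), of u] sq[OF assms(2), of v] have "\<bar>u\<bar> \<le> ?m" "\<bar>v\<bar> \<le> ?m" by linarith+
    then show "z \<in> {-?m..?m} \<times> {-?m..?m}" unfolding uv by auto
  qed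
qed simp

lemma qform_scale: "real (qform g h (int e * u, int e * v)) = (real e)\<^sup>2 * real (qform g h (u, v))"
  unfolding real_qform by (simp add: power_mult_distrib algebra_simps)

text \<open>Such an \<open>e\<close> is prime to 2, \<open>g\<close> and \<open>h\<close>, so
  multiplication by \<open>e\<close> changes neither parities nor coprimality with \<open>g\<close>
  and \<open>h\<close>.\<close>

lemma parity_pairs_scale:
  assumes e: "\<forall>p\<in>prime_factors (2 * (g * h)). \<not> p dvd e" and gh: "g > 0" "h > 0"
  shows "(int e * u, int e * v) \<in> parity_pairs g h b c \<longleftrightarrow> (u, v) \<in> parity_pairs g h b c"
proof -
  have 1: "coprime e (2 * (g * h))"
  proof (rule ccontr)
    assume "\<not> coprime e (2 * (g * h))"
    then have "gcd e (2 * (g * h)) \<noteq> 1" using coprime_iff_gcd_eq_1 by blast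
    then obtain p where p: "prime p" "p dvd gcd e (2 * (g * h))" using prime_factor_nat by blast
    then have "p dvd e" "p dvd 2 * (g * h)" using gcd_greatest_iff by blast+
    then show False using p(1) e gh by (auto simp: in_prime_factors_iff)
  qed
  then have "coprime (int e) (int g)" "coprime (int e) (int h)" "odd e"
    by (auto simp: coprime_int_iff)
  then show ?thesis by (auto simp: parity_pairs_def coprime_with_parity_def)
qed

text \<open>Group the pairs by e = gcd(u, v). A prime dividing \<open>e\<close> cannot divide
  \<open>h\<close> (u is prime to it), nor \<open>g\<close> (v is prime to it), nor be 2 (u and v
  are not both even). The last condition also excludes the origin.\<close>

lemma parity_pairs_decomp:
  assumes gh: "g > 0" "h > 0" and bc: "\<not> (b \<and> c)"
  shows "{z \<in> parity_pairs g h b c. real (qform g h z) \<le> x} =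
    (\<Union>e\<in>{e. e > 0 \<and> (\<forall>p\<in>prime_factors (2 * (g * h)). \<not> p dvd e)}.
       (\<lambda>(u, v). (int e * u, int e * v)) `
         {z \<in> primitive_pairs g h b c. real (qform g h z) \<le> x / (real e)\<^sup>2})"
    (is "?L = (\<Union>e\<in>?E. ?F e)")
proof (intro equalityI subsetI)
  fix z assume z: "z \<in> ?L"
  obtain u v where uv: "z = (u, v)" by (cases z)
  define e where "e = nat (gcd u v)"
  have pp: "(u, v) \<in> parity_pairs g h b c" using z uv by simp
  have "u \<noteq> 0 \<or> v \<noteq> 0" using pp bc by (auto simp: parity_pairs_def coprime_with_parity_def)
  then have e0: "e > 0" and int_e: "int e = gcd u v" by (auto simp: e_def)
  have "\<not> p dvd e" if p: "p \<in> prime_factors (2 * (g * h))" for p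
  proof
    assume "p dvd e"
    then have "int p dvd gcd u v" unfolding int_e[symmetric] by simp
    then have d: "int p dvd u" "int p dvd v" by simp_all
    have prime: "prime p" and "p dvd 2 * (g * h)" using p by (auto simp: in_prime_factors_iff)
    then consider "p = 2" | "p dvd g" | "p dvd h"
      by (metis prime_dvd_multD primes_dvd_imp_eq two_is_prime_nat)
    then show False
    proof cases
      case 1
      then show False using d pp bc by (auto simp: parity_pairs_def coprime_with_parity_def)
    next
      case 2
      then have "int p dvd int g" by simp
      moreover have "coprime v (int g)" using pp by (auto simp: parity_pairs_def coprime_with_parity_def)
      ultimately have "is_unit (int p)" using d(2) by (meson coprime_common_divisor)
      then show False using prime by (auto simp: prime_nat_iff)
    next
      case 3
      then have "int p dvd int h" by simp
      moreover have "coprime u (int h)" using pp by (auto simp: parity_pairs_def coprime_with_parity_def)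
      ultimately have "is_unit (int p)" using d(1) by (meson coprime_common_divisor)
      then show False using prime by (auto simp: prime_nat_iff)
    qed
  qed
  then have eE: "e \<in> ?E" using e0 by blast
  define u' v' where "u' = u div gcd u v" and "v' = v div gcd u v"
  have u: "u = int e * u'" and v: "v = int e * v'" by (simp_all add: u'_def v'_def int_e)
  have "coprime u' v'" unfolding u'_def v'_def using \<open>u \<noteq> 0 \<or> v \<noteq> 0\<close> by (intro div_gcd_coprime) auto
  moreover have "(u', v') \<in> parity_pairs g h b c"
    using pp eE gh unfolding u v by (subst (asm) parity_pairs_scale) auto
  moreover have "(real e)\<^sup>2 * real (qform g h (u', v')) \<le> x"
    using z unfolding uv u v by (simp add: qform_scale)
  then have "real (qform g h (u', v')) \<le> x / (real e)\<^sup>2"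
    using e0 by (simp add: pos_le_divide_eq mult.commute)
  ultimately have "(u', v') \<in> {z \<in> primitive_pairs g h b c. real (qform g h z) \<le> x / (real e)\<^sup>2}"
    by (simp add: primitive_pairs_def)
  moreover have "z = (\<lambda>(u, v). (int e * u, int e * v)) (u', v')"
    unfolding uv by (simp flip: u v)
  ultimately have "z \<in> ?F e" by (rule rev_image_eqI)
  then show "z \<in> (\<Union>e\<in>?E. ?F e)" by (rule UN_I[OF eE])
next
  fix z assume "z \<in> (\<Union>e\<in>?E. ?F e)"
  then obtain e u v where e: "e \<in> ?E" and z: "z = (int e * u, int e * v)"
    and uv: "(u, v) \<in> primitive_pairs g h b c" "real (qform g h (u, v)) \<le> x / (real e)\<^sup>2" by auto
  have "(real e)\<^sup>2 * real (qform g h (u, v)) \<le> x"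
    using uv(2) e by (simp add: pos_le_divide_eq mult.commute)
  moreover have "(int e * u, int e * v) \<in> parity_pairs g h b c"
    using uv(1) e gh by (subst parity_pairs_scale) (auto simp: primitive_pairs_def)
  ultimately show "z \<in> ?L" unfolding z by (simp add: qform_scale)
qed

lemma primitive_pairs_nonzero: "z \<in> primitive_pairs g h b c \<Longrightarrow> z \<noteq> (0, 0)"
  by (auto simp: primitive_pairs_def)

text \<open>The gcd decomposition reads B x = sum of A (x / e^2) over e prime to 2 g h. Dividing by
  x turns it into a weighted mean with weights 1 / e^2, the relation that
  \<open>sieve_contraction\<close> inverts.\<close>

lemma primitive_pairs_density:
  assumes gh: "odd g" "odd h" and bc: "\<not> (b \<and> c)"
  defines "P \<equiv> prime_factors (2 * (g * h))"
  shows "((\<lambda>x. real (card {z \<in> primitive_pairs g h b c. real (qform g h z) \<le> x}) / x) \<longlongrightarrow>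
     (real (totient h) / real h / 2) * (real (totient g) / real g / 2) * pi / sqrt (real g * real h)
       / (pi\<^sup>2 / 6 * (\<Prod>p\<in>P. 1 - 1 / (real p)\<^sup>2))) at_top"
proof -
  have pos: "g > 0" "h > 0" using gh by (auto intro: odd_pos)
  define A where "A x = real (card {z \<in> primitive_pairs g h b c. real (qform g h z) \<le> x})" for x
  define B where "B x = real (card {z \<in> parity_pairs g h b c. real (qform g h z) \<le> x})" for x
  let ?b = "(real (totient h) / real h / 2) * (real (totient g) / real g / 2) * pi / sqrt (real g * real h)"
  have eq: "{(u, v). u \<in> coprime_with_parity h b \<and> v \<in> coprime_with_parity g c
      \<and> real g * (of_int u)\<^sup>2 + real h * (of_int v)\<^sup>2 \<le> x}
      = {z \<in> parity_pairs g h b c. real (qform g h z) \<le> x}" for x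
    by (auto simp: parity_pairs_def real_qform)
  have B_lim: "((\<lambda>x. B x / x) \<longlongrightarrow> ?b) at_top"
    using lattice_points_ellipse_tendsto[of "real g" "real h",
        OF _ _ has_int_density_coprime_with_parity[OF gh(2), of b]
          has_int_density_coprime_with_parity[OF gh(1), of c], unfolded eq, folded B_def] pos
    by simp
  have A_small: "A x = 0" if "x < 1" for x
  proof -
    have "{z \<in> primitive_pairs g h b c. real (qform g h z) \<le> x} = {}"
      using qform_pos[OF pos primitive_pairs_nonzero] that by force
    then show ?thesis unfolding A_def by (simp only: card.empty of_nat_0)
  qed
  have A_le_B: "A x \<le> B x" for x
    unfolding A_def B_def by (intro of_nat_mono card_mono finite_qform_le pos) (auto simp: primitive_pairs_def)
  have A_mono: "A x \<le> A y" if "x \<le> y" for x y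
    unfolding A_def using that by (intro of_nat_mono card_mono finite_qform_le pos) auto
  have "\<forall>\<^sub>F x in at_top. B x / x < ?b + 1" using B_lim by (rule order_tendstoD) simp
  then obtain x0 where x0: "\<And>x. x \<ge> x0 \<Longrightarrow> B x / x < ?b + 1" unfolding eventually_at_top_linorder by blast
  \<comment> \<open>One constant for all x > 0: below 1 the count is 0, from 1 to \<open>x0\<close>
    monotonicity gives A x0, and beyond \<open>x0\<close> the density of the larger set takes
    over.\<close>
  define C where "C = A x0 + \<bar>?b + 1\<bar>"
  have A0: "A x \<ge> 0" for x by (simp add: A_def)
  have A_bound: "\<bar>A x\<bar> \<le> C * x" if x: "x > 0" for x
  proof -
    consider "x < 1" | "x \<ge> 1" "x \<le> x0" | "x \<ge> x0" by linarith
    then show ?thesis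
    proof cases
      case 1
      have "C \<ge> 0" using A0[of x0] by (simp add: C_def)
      then show ?thesis using A_small[OF 1] x by simp
    next
      case 2
      have "\<bar>A x\<bar> \<le> A x0" using A_mono[OF 2(2)] A0[of x] by simp
      also have "\<dots> \<le> C * 1" by (simp add: C_def)
      also have "\<dots> \<le> C * x" using 2(1) A0[of x0] by (intro mult_left_mono) (auto simp: C_def)
      finally show ?thesis .
    next
      case 3
      have "B x < (?b + 1) * x" using x0[OF 3] x by (simp only: pos_divide_less_eq)
      also have "\<dots> \<le> C * x" using x A0[of x0] by (intro mult_right_mono) (auto simp: C_def)
      finally show ?thesis using A0[of x] A_le_B[of x] by simp
    qed
  qed
  have primeP: "finite P" "\<And>p. p \<in> P \<Longrightarrow> prime p" "2 \<in> P"
    using pos by (auto simp: P_def in_prime_factors_iff)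
  have "((\<lambda>x. A x / x) \<longlongrightarrow> ?b / (pi\<^sup>2 / 6 * (\<Prod>p\<in>P. 1 - 1 / (real p)\<^sup>2))) at_top"
  proof (rule sieve_contraction[where w = "coprime_weight P" and B = B and C = C])
    show "coprime_weight P 0 = 0" by (simp add: coprime_weight_def)
    show "coprime_weight P 1 = 1" using primeP(2)[of 1] by (auto simp: coprime_weight_def)
    show "coprime_weight P e \<ge> 0" for e by (simp add: coprime_weight_def)
    show "coprime_weight P sums (pi\<^sup>2 / 6 * (\<Prod>p\<in>P. 1 - 1 / (real p)\<^sup>2))"
      by (rule coprime_weight_sums) (use primeP in auto)
    show "pi\<^sup>2 / 6 * (\<Prod>p\<in>P. 1 - 1 / (real p)\<^sup>2) < 2"
      by (rule coprime_weight_limit_less_2) (use primeP in auto)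
    fix x :: real and M :: nat assume x: "x > 0" "x \<le> real M"
    let ?E = "{e. e > 0 \<and> (\<forall>p\<in>P. \<not> p dvd e)}"
    let ?G = "\<lambda>e. {z \<in> primitive_pairs g h b c. real (qform g h z) \<le> x / (real e)\<^sup>2}"
    let ?F = "\<lambda>e. (\<lambda>(u, v). (int e * u, int e * v)) ` ?G e"
    \<comment> \<open>For e > M >= x we have x / e^2 < 1, while nonzero pairs have value at least 1;
      so the union over \<open>e\<close> is finite.\<close>
    have empty: "?G e = {}" if "e > M" for e
    proof -
      have "real e * 1 \<le> real e * real e" using that by (intro mult_left_mono) auto
      then have "x < real e * real e" using that x by linarith
      then have "x < (real e)\<^sup>2" by (simp only: power2_eq_square)
      then have "x / (real e)\<^sup>2 < 1" using that by simp
      then show ?thesis using qform_pos[OF pos primitive_pairs_nonzero] by force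
    qed
    have "{z \<in> parity_pairs g h b c. real (qform g h z) \<le> x} = (\<Union>e\<in>?E. ?F e)"
      unfolding P_def by (rule parity_pairs_decomp[OF pos bc])
    also have "\<dots> = (\<Union>e\<in>?E \<inter> {..M}. ?F e)"
    proof (intro equalityI subsetI)
      fix z assume "z \<in> (\<Union>e\<in>?E. ?F e)"
      then obtain e where e: "e \<in> ?E" "z \<in> ?F e" by (rule UN_E)
      have "e \<le> M"
      proof (rule ccontr)
        assume "\<not> e \<le> M"
        then have "?G e = {}" by (intro empty) simp
        then show False using e(2) by (simp only: image_empty empty_iff)
      qed
      then show "z \<in> (\<Union>e\<in>?E \<inter> {..M}. ?F e)" using e by (intro UN_I[of e]) auto
    next
      fix z assume "z \<in> (\<Union>e\<in>?E \<inter> {..M}. ?F e)"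
      then obtain e where e: "e \<in> ?E \<inter> {..M}" "z \<in> ?F e" by (rule UN_E)
      then show "z \<in> (\<Union>e\<in>?E. ?F e)" by (intro UN_I[of e]) simp_all
    qed
    finally have "B x = real (card (\<Union>e\<in>?E \<inter> {..M}. ?F e))" unfolding B_def by (simp only:)
    also have "card (\<Union>e\<in>?E \<inter> {..M}. ?F e) = (\<Sum>e\<in>?E \<inter> {..M}. card (?F e))"
    proof (rule card_UN_disjoint)
      show "\<forall>e\<in>?E \<inter> {..M}. finite (?F e)" by (intro ballI finite_imageI finite_qform_le pos)
      \<comment> \<open>The pieces are disjoint because the gcd of the coordinates recovers
        \<open>e\<close>.\<close>
      have gcd: "gcd (fst z) (snd z) = int e" if "z \<in> ?F e" for z e
        using that by (auto simp: primitive_pairs_def gcd_mult_left coprime_iff_gcd_eq_1)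
      show "\<forall>i\<in>?E \<inter> {..M}. \<forall>j\<in>?E \<inter> {..M}. i \<noteq> j \<longrightarrow> ?F i \<inter> ?F j = {}"
      proof (intro ballI impI)
        fix i j :: nat assume "i \<noteq> j"
        show "?F i \<inter> ?F j = {}"
        proof (rule equals0I)
          fix z assume z: "z \<in> ?F i \<inter> ?F j"
          have "int i = int j" using gcd[OF IntD1[OF z]] gcd[OF IntD2[OF z]] by simp
          then show False using \<open>i \<noteq> j\<close> by simp
        qed
      qed
    qed simp
    also have "\<dots> = (\<Sum>e\<in>?E \<inter> {..M}. card (?G e))"
      by (intro sum.cong refl card_image) (auto simp: inj_on_def)
    finally have "B x / x = (\<Sum>e\<in>?E \<inter> {..M}. A (x / (real e)\<^sup>2) / x)"
      by (simp add: A_def sum_divide_distrib)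
    also have "\<dots> = (\<Sum>e\<in>?E \<inter> {..M}. coprime_weight P e * (A (x / (real e)\<^sup>2) / (x / (real e)\<^sup>2)))"
      by (intro sum.cong refl) (auto simp: coprime_weight_def)
    also have "\<dots> = (\<Sum>e\<le>M. coprime_weight P e * (A (x / (real e)\<^sup>2) / (x / (real e)\<^sup>2)))"
      by (intro sum.mono_neutral_left) (auto simp: coprime_weight_def)
    finally show "B x / x = (\<Sum>e\<le>M. coprime_weight P e * (A (x / (real e)\<^sup>2) / (x / (real e)\<^sup>2)))" .
  qed (use A_small A_bound B_lim in auto)
  then show ?thesis unfolding A_def .
qed

section \<open>Parametrizing pairs of equal value\<close>

definition equal_value_pairs :: "nat \<Rightarrow> nat \<Rightarrow> ((int \<times> int) \<times> (int \<times> int)) set" where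
  "equal_value_pairs N n = {((x, y), (z, w)). x\<^sup>2 + int N * y\<^sup>2 = z\<^sup>2 + int N * w\<^sup>2
     \<and> 1 \<le> x\<^sup>2 + int N * y\<^sup>2 \<and> x\<^sup>2 + int N * y\<^sup>2 \<le> int n}"

lemma sum_r2_squared:
  assumes "N > 0"
  shows "(\<Sum>m=1..n. (r2 N m)\<^sup>2) = card (equal_value_pairs N n)"
proof -
  let ?R = "\<lambda>m. {(x :: int, y :: int). x\<^sup>2 + int N * y\<^sup>2 = int m}"
  have R: "?R m = {z \<in> UNIV. real (qform 1 N z) \<le> real m} \<inter> {z. qform 1 N z = m}" for m
  proof -
    have "x\<^sup>2 + int N * y\<^sup>2 = int m \<longleftrightarrow> qform 1 N (x, y) = m" for x y
    proof -
      have "int (qform 1 N (x, y)) = x\<^sup>2 + int N * y\<^sup>2" by (simp add: qform_def)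
      then show ?thesis by (metis of_nat_eq_iff)
    qed
    then show ?thesis by auto
  qed
  have fin: "finite (?R m)" for m
    unfolding R by (intro finite_Int disjI1 finite_qform_le) (use assms in auto)
  have "equal_value_pairs N n = (\<Union>m\<in>{1..n}. ?R m \<times> ?R m)"
  proof (intro equalityI subsetI)
    fix s assume "s \<in> equal_value_pairs N n"
    then obtain x y z w where s: "s = ((x, y), (z, w))" "x\<^sup>2 + int N * y\<^sup>2 = z\<^sup>2 + int N * w\<^sup>2"
      "1 \<le> x\<^sup>2 + int N * y\<^sup>2" "x\<^sup>2 + int N * y\<^sup>2 \<le> int n" unfolding equal_value_pairs_def by blast
    then have "nat (x\<^sup>2 + int N * y\<^sup>2) \<in> {1..n}" "s \<in> ?R (nat (x\<^sup>2 + int N * y\<^sup>2)) \<times> ?R (nat (x\<^sup>2 + int N * y\<^sup>2))"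
      by auto
    then show "s \<in> (\<Union>m\<in>{1..n}. ?R m \<times> ?R m)" by blast
  next
    fix s assume "s \<in> (\<Union>m\<in>{1..n}. ?R m \<times> ?R m)"
    then show "s \<in> equal_value_pairs N n" by (auto simp: equal_value_pairs_def)
  qed
  then have "card (equal_value_pairs N n) = card (\<Union>m\<in>{1..n}. ?R m \<times> ?R m)" by simp
  also have "\<dots> = (\<Sum>m=1..n. card (?R m \<times> ?R m))"
    by (rule card_UN_disjoint) (use fin in auto)
  also have "\<dots> = (\<Sum>m=1..n. (r2 N m)\<^sup>2)"
    by (intro sum.cong refl) (simp add: card_cartesian_product r2_def power2_eq_square)
  finally show ?thesis by simp
qed

text \<open>The image of \<open>equal_value_pairs\<close> under (x - z, x + z, w - y, w + y). The
  parities make x = (a + b) / 2 and w = (c + d) / 2 integral, and the weighted sum of squares is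
  four times the common value, hence 4 n.\<close>

definition split_quads :: "nat \<Rightarrow> nat \<Rightarrow> (int \<times> int \<times> int \<times> int) set" where
  "split_quads N n = {(a, b, c, d). a * b = int N * (c * d) \<and> (a, b, c, d) \<noteq> (0, 0, 0, 0)
     \<and> even (a + b) \<and> even (c + d) \<and> a\<^sup>2 + b\<^sup>2 + int N * c\<^sup>2 + int N * d\<^sup>2 \<le> 4 * int n}"

lemma card_split_quads:
  assumes "N > 0"
  shows "card (split_quads N n) = card (equal_value_pairs N n)"
proof -
  let ?T = "\<lambda>((x, y), (z, w)). (x - z, x + z, w - y, w + y) :: int \<times> int \<times> int \<times> int"
  have norm: "(x - z)\<^sup>2 + (x + z)\<^sup>2 + int N * (w - y)\<^sup>2 + int N * (w + y)\<^sup>2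
      = 2 * (x\<^sup>2 + int N * y\<^sup>2) + 2 * (z\<^sup>2 + int N * w\<^sup>2)" for x y z w :: int
    by (simp add: power2_eq_square algebra_simps)
  have ge1: "1 \<le> p" if "0 \<le> p" "p \<noteq> 0" for p :: int using that by simp
  have lin: "2 * p + 2 * q \<le> 4 * m \<longleftrightarrow> p \<le> m" if "p = q" for p q m :: int using that by simp
  have prod: "(x - z) * (x + z) = int N * ((w - y) * (w + y)) \<longleftrightarrow> x\<^sup>2 + int N * y\<^sup>2 = z\<^sup>2 + int N * w\<^sup>2"
    for x y z w :: int
    by (auto simp: power2_eq_square algebra_simps)
  have "?T ` equal_value_pairs N n = split_quads N n"
  proof (intro equalityI subsetI)
    fix q assume "q \<in> ?T ` equal_value_pairs N n"
    then obtain x y z w where q: "q = (x - z, x + z, w - y, w + y)"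
      and e: "x\<^sup>2 + int N * y\<^sup>2 = z\<^sup>2 + int N * w\<^sup>2" "1 \<le> x\<^sup>2 + int N * y\<^sup>2" "x\<^sup>2 + int N * y\<^sup>2 \<le> int n"
      unfolding equal_value_pairs_def by auto
    have "(x - z, x + z, w - y, w + y) \<noteq> (0, 0, 0, 0)"
    proof
      assume "(x - z, x + z, w - y, w + y) = (0, 0, 0, 0)"
      then have "x = 0" "y = 0" by auto
      then show False using e(2) by simp
    qed
    moreover have "even (x - z + (x + z))" "even (w - y + (w + y))" by simp_all
    moreover have "2 * (x\<^sup>2 + int N * y\<^sup>2) + 2 * (z\<^sup>2 + int N * w\<^sup>2) \<le> 4 * int n"
      using lin[OF e(1)] e(3) by (simp only:)
    ultimately show "q \<in> split_quads N n"
      unfolding q split_quads_def using prod[of x z w y] e(1) norm[of x z w y] by simp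
  next
    fix q assume "q \<in> split_quads N n"
    then obtain a b c d where q: "q = (a, b, c, d)" and e: "a * b = int N * (c * d)"
      "(a, b, c, d) \<noteq> (0, 0, 0, 0)" "even (a + b)" "even (c + d)"
      "a\<^sup>2 + b\<^sup>2 + int N * c\<^sup>2 + int N * d\<^sup>2 \<le> 4 * int n"
      unfolding split_quads_def by auto
    obtain x where x: "a + b = 2 * x" using e(3) by (elim evenE)
    obtain w where w: "c + d = 2 * w" using e(4) by (elim evenE)
    define z y where "z = x - a" and "y = w - c"
    have abcd: "a = x - z" "b = x + z" "c = w - y" "d = w + y"
      using x w by (auto simp: z_def y_def)
    have 1: "x\<^sup>2 + int N * y\<^sup>2 = z\<^sup>2 + int N * w\<^sup>2"
      using e(1) prod[of x z w y] unfolding abcd by simp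
    have 2: "x\<^sup>2 + int N * y\<^sup>2 \<le> int n"
      using e(5) lin[OF 1] unfolding abcd norm by (simp only:)
    have "0 \<le> x\<^sup>2 + int N * y\<^sup>2" by simp
    moreover have "x\<^sup>2 + int N * y\<^sup>2 \<noteq> 0"
    proof
      assume 0: "x\<^sup>2 + int N * y\<^sup>2 = 0"
      have sq: "s = 0 \<and> t = 0" if "s\<^sup>2 + int N * t\<^sup>2 = 0" for s t :: int
        using that assms add_nonneg_eq_0_iff[of "s\<^sup>2" "int N * t\<^sup>2"] by simp
      show False using sq[OF 0] sq[of z w] 0 1 e(2) unfolding abcd by simp
    qed
    ultimately have "1 \<le> x\<^sup>2 + int N * y\<^sup>2" by (rule ge1)
    with 1 2 have "((x, y), (z, w)) \<in> equal_value_pairs N n" by (simp add: equal_value_pairs_def)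
    then have "?T ((x, y), (z, w)) \<in> ?T ` equal_value_pairs N n" by (rule imageI)
    then show "q \<in> ?T ` equal_value_pairs N n" unfolding q abcd by simp
  qed
  moreover have "card (?T ` equal_value_pairs N n) = card (equal_value_pairs N n)"
    by (rule card_image, rule inj_onI) auto
  ultimately show ?thesis by (simp only:)
qed

text \<open>The conditions of \<open>split_quads\<close> for (g u k, h v l, v k, u l): for odd
  \<open>g\<close> and \<open>h\<close> the two sums are even exactly as stated here, and the
  weighted sum of squares is the product of the two form values.\<close>

definition split_params :: "nat \<Rightarrow> nat \<Rightarrow> nat \<Rightarrow> ((int \<times> int) \<times> (int \<times> int)) set" where
  "split_params g h n = {((u, v), (k, l)). coprime (int g * u) (int h * v) \<and> (k, l) \<noteq> (0, 0)
      \<and> even (u * k + v * l) \<and> even (v * k + u * l) \<and> qform g h (u, v) * qform g h (k, l) \<le> 4 * n}"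

section \<open>Existence and uniqueness of the parametrization\<close>

lemma squarefree_imp_coprime:
  fixes g h :: nat
  assumes "squarefree (g * h)"
  shows "coprime g h"
proof (rule coprimeI)
  fix c assume "c dvd g" "c dvd h"
  then have "c\<^sup>2 dvd g * h" by (simp add: power2_eq_square mult_dvd_mono)
  then show "is_unit c" using assms squarefreeD by blast
qed

text \<open>Here \<open>k = gcd a c\<close>, \<open>(g u, v)\<close> is the primitive vector proportional to \<open>(a, c)\<close> and
  \<open>g = gcd (a / k) N\<close>.\<close>

lemma split_quad_exists:
  fixes a b c d :: int
  assumes N: "squarefree N" "N > 0" and eq: "a * b = int N * (c * d)" and ac: "a \<noteq> 0 \<or> c \<noteq> 0"
  shows "\<exists>g h u v k l. g * h = N \<and> coprime (int g * u) (int h * v) \<and> k \<noteq> 0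
     \<and> a = int g * u * k \<and> b = int h * v * l \<and> c = v * k \<and> d = u * l"
proof -
  define k where "k = gcd a c"
  have k0: "k \<noteq> 0" using ac by (simp add: k_def)
  define p v where "p = a div k" and "v = c div k"
  have a: "a = p * k" and c: "c = v * k" by (simp_all add: p_def v_def k_def)
  have pv: "coprime p v" unfolding p_def v_def k_def using ac by (intro div_gcd_coprime) auto
  define g where "g = nat (gcd p (int N))"
  have int_g: "int g = gcd p (int N)" by (simp add: g_def)
  have "int g dvd int N" unfolding int_g by simp
  then have "g dvd N" by simp
  then obtain h where h: "N = g * h" by (elim dvdE)
  have gh0: "g > 0" "h > 0" using N(2) h by auto
  have "int g dvd p" unfolding int_g by simp
  then obtain u where u: "p = int g * u" by (elim dvdE)
  have "coprime (p div int g) (int N div int g)"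
    unfolding int_g using N(2) by (intro div_gcd_coprime) simp
  moreover have "p div int g = u" "int N div int g = int h" using gh0 unfolding u h by simp_all
  ultimately have uh: "coprime u (int h)" by simp
  have gh: "coprime g h" using N(1) unfolding h by (rule squarefree_imp_coprime)
  have cop: "coprime (int g * u) (int h * v)"
    using pv uh gh unfolding u by simp
  have uv: "coprime u v" using pv unfolding u by simp
  have "(int g * k) * (u * b) = (int g * k) * (int h * v * d)"
    using eq unfolding a c u h by (simp add: algebra_simps)
  then have ub: "u * b = int h * v * d" using gh0 k0 by simp
  have "\<exists>l. b = int h * v * l \<and> d = u * l"
  proof (cases "u = 0")
    \<comment> \<open>If u = 0, coprimality leaves h = 1 and v = 1 or -1, so d = 0. As v v = 1, the
      witness l = v b gives b = h v l.\<close>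
    case True
    have h1: "h = 1" using uh True by simp
    have "\<bar>v\<bar> = 1" using uv True by simp
    then have v: "v = 1 \<or> v = -1" by linarith
    then have "d = 0" using ub True gh0 by auto
    moreover have "b = v * (v * b)" using v by auto
    ultimately show ?thesis using True h1 by (intro exI[of _ "v * b"]) simp
  next
    case False
    have "u dvd (int h * v) * d" by (metis ub dvd_triv_left)
    moreover have "coprime u (int h * v)" using uh uv by simp
    ultimately have "u dvd d" using coprime_dvd_mult_right_iff by blast
    then obtain l where l: "d = u * l" by (elim dvdE)
    have "u * b = u * (int h * v * l)" using ub unfolding l by (simp add: algebra_simps)
    then have "b = int h * v * l" using False by simp
    with l show ?thesis by blast
  qed
  then obtain l where "b = int h * v * l" "d = u * l" by blast
  then show ?thesis using h cop k0 a c unfolding u by blast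
qed

text \<open>The parameters can be read off: |k| = gcd(a, c) since g u and v are coprime, the
  quotients of a and c by k give g u and v, and g = gcd(g u, N) since u is prime to h. Only the sign
  of k is free, and it propagates to u, v and l.\<close>

lemma split_quad_unique:
  fixes u v k l u' v' k' l' :: int
  assumes N: "g * h = N" "g' * h' = N" "N > 0"
    and cop: "coprime (int g * u) (int h * v)" "coprime (int g' * u') (int h' * v')"
    and eqs: "int g * u * k = int g' * u' * k'" "int h * v * l = int h' * v' * l'"
      "v * k = v' * k'" "u * l = u' * l'"
    and k: "k \<noteq> 0"
  shows "\<exists>s\<in>{1, -1}. g' = g \<and> h' = h \<and> u' = s * u \<and> v' = s * v \<and> k' = s * k \<and> l' = s * l"
proof -
  have c1: "coprime (int g * u) v" "coprime (int g' * u') v'" using cop by simp_all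
  have gcd_abs: "gcd (x * t) (y * t) = \<bar>t\<bar>" if "coprime x y" for x y t :: int
  proof -
    have "gcd y x = 1" using that by (simp add: coprime_iff_gcd_eq_1 gcd.commute)
    then show ?thesis by (simp add: gcd_mult_right)
  qed
  have "gcd (int g * u * k) (v * k) = \<bar>k\<bar>" by (rule gcd_abs[OF c1(1)])
  moreover have "gcd (int g' * u' * k') (v' * k') = \<bar>k'\<bar>" by (rule gcd_abs[OF c1(2)])
  ultimately have "\<bar>k\<bar> = \<bar>k'\<bar>" using eqs by simp
  then have "k' = k \<or> k' = - k" by linarith
  then have "\<exists>s\<in>{1, -1}. k' = s * k" by auto
  then obtain s where s: "s \<in> {1, -1}" "k' = s * k" by (rule bexE)
  have ss: "s * (s * t) = t" for t using s(1) by auto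
  have "(int g * u) * k = (s * (int g' * u')) * k" using eqs(1) unfolding s(2) by (simp add: algebra_simps)
  then have gu: "int g * u = s * (int g' * u')" using k by simp
  have "v * k = (s * v') * k" using eqs(3) unfolding s(2) by (simp add: algebra_simps)
  then have v: "v = s * v'" using k by simp
  have gcdN: "gcd (int g * u) (int (g * h)) = int g" if "coprime (int g * u) (int h * v)" for g h :: nat and u v
  proof -
    have "coprime u (int h)" using that by simp
    then have "gcd u (int h) = 1" unfolding coprime_iff_gcd_eq_1 .
    then show ?thesis by (simp add: gcd_mult_left)
  qed
  have "gcd (int g * u) (int N) = gcd (int g' * u') (int N)"
    unfolding gu using s(1) by auto
  then have g: "g' = g" using gcdN[OF cop(1)] gcdN[OF cop(2)] N by simp
  have gh0: "g > 0" "h > 0" using N by auto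
  have "g * h' = g * h" using N(1,2) unfolding g by simp
  then have h: "h' = h" using gh0(1) by simp
  have "int g * u = int g * (s * u')" using gu unfolding g by (simp add: algebra_simps)
  then have u: "u = s * u'" using gh0 by simp
  have "h * (s * v' * l) = h * (v' * l')" using eqs(2) unfolding h v by (simp add: algebra_simps)
  then have vl: "v' * (s * l) = v' * l'" using gh0 by (simp add: algebra_simps)
  have ul: "u' * (s * l) = u' * l'" using eqs(4) unfolding u by (simp add: algebra_simps)
  \<comment> \<open>Either of u', v' may vanish, so l' is determined through whichever is
    nonzero.\<close>
  have "u' \<noteq> 0 \<or> v' \<noteq> 0" using cop(2) by auto
  then have "l' = s * l" using vl ul by auto
  moreover have "u' = s * u" "v' = s * v" unfolding u v ss by simp_all
  ultimately show ?thesis using s g h by (intro bexI[of _ s] conjI)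
qed

text \<open>The case \<open>a = c = 0\<close> follows from the symmetry that exchanges \<open>(a, c)\<close> with \<open>(b, d)\<close>.\<close>

lemma split_quad_exists':
  fixes a b c d :: int
  assumes N: "squarefree N" "N > 0" and eq: "a * b = int N * (c * d)" and nz: "(a, b, c, d) \<noteq> (0, 0, 0, 0)"
  shows "\<exists>g h u v k l. g * h = N \<and> coprime (int g * u) (int h * v) \<and> (k, l) \<noteq> (0, 0)
     \<and> a = int g * u * k \<and> b = int h * v * l \<and> c = v * k \<and> d = u * l"
proof (cases "a \<noteq> 0 \<or> c \<noteq> 0")
  case True
  from split_quad_exists[OF N eq True] obtain g h u v k l where
    "g * h = N" "coprime (int g * u) (int h * v)" "k \<noteq> 0"
    "a = int g * u * k" "b = int h * v * l" "c = v * k" "d = u * l" by (elim exE conjE)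
  then show ?thesis
    by (intro exI[of _ g] exI[of _ h] exI[of _ u] exI[of _ v] exI[of _ k] exI[of _ l]) simp
next
  case False
  then have bd: "b \<noteq> 0 \<or> d \<noteq> 0" using nz by simp
  have eq': "b * a = int N * (d * c)" using eq by (simp add: mult.commute)
  from split_quad_exists[OF N eq' bd] obtain g h u v k l where
    *: "g * h = N" "coprime (int g * u) (int h * v)" "k \<noteq> 0"
    "b = int g * u * k" "a = int h * v * l" "d = v * k" "c = u * l"
    by (elim exE conjE)
  have "h * g = N" "coprime (int h * v) (int g * u)" "(l, k) \<noteq> (0, 0)"
    using *(1-3) by (simp_all only: mult.commute[of h g] coprime_commute[of "int h * v"]) simp
  then show ?thesis using *(4-7)
    by (intro exI[of _ h] exI[of _ g] exI[of _ v] exI[of _ u] exI[of _ l] exI[of _ k] conjI)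
qed

text \<open>If k = 0, then l is nonzero, and exchanging (g, u, k) with (h, v, l) reduces to the
  previous case.\<close>

lemma split_quad_unique':
  fixes u v k l u' v' k' l' :: int
  assumes N: "g * h = N" "g' * h' = N" "N > 0"
    and cop: "coprime (int g * u) (int h * v)" "coprime (int g' * u') (int h' * v')"
    and eqs: "int g * u * k = int g' * u' * k'" "int h * v * l = int h' * v' * l'"
      "v * k = v' * k'" "u * l = u' * l'"
    and kl: "(k, l) \<noteq> (0, 0)"
  shows "\<exists>s\<in>{1, -1}. g' = g \<and> h' = h \<and> u' = s * u \<and> v' = s * v \<and> k' = s * k \<and> l' = s * l"
proof (cases "k = 0")
  case False
  then show ?thesis by (rule split_quad_unique[OF N cop eqs])
next
  case True
  then have l: "l \<noteq> 0" using kl by simp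
  have N': "h * g = N" "h' * g' = N" using N by (simp_all only: mult.commute)
  have "\<exists>s\<in>{1, -1}. h' = h \<and> g' = g \<and> v' = s * v \<and> u' = s * u \<and> l' = s * l \<and> k' = s * k"
    by (rule split_quad_unique[OF N' N(3) _ _ eqs(2,1,4,3) l]) (use cop in \<open>simp_all only: coprime_commute\<close>)
  then show ?thesis by blast
qed

text \<open>Both form values are at least 1, so a bound on their product bounds each of
  them.\<close>

lemma finite_split_params:
  assumes "g > 0" "h > 0"
  shows "finite (split_params g h n)"
proof (rule finite_subset)
  let ?F = "{z \<in> UNIV. real (qform g h z) \<le> real (4 * n)}"
  show "split_params g h n \<subseteq> ?F \<times> ?F"
  proof
    fix s assume "s \<in> split_params g h n"
    then obtain u v k l where s: "s = ((u, v), (k, l))" "coprime (int g * u) (int h * v)" "(k, l) \<noteq> (0, 0)"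
      "qform g h (u, v) * qform g h (k, l) \<le> 4 * n"
      unfolding split_params_def by blast
    have "(u, v) \<noteq> (0, 0)" using s(2) by auto
    then have ge: "1 \<le> qform g h (u, v)" "1 \<le> qform g h (k, l)"
      using qform_pos[OF assms] s(3) by (simp_all add: Suc_leI)
    have "qform g h (u, v) * 1 \<le> qform g h (u, v) * qform g h (k, l)"
      using ge(2) by (rule mult_le_mono2)
    moreover have "1 * qform g h (k, l) \<le> qform g h (u, v) * qform g h (k, l)"
      using ge(1) by (rule mult_le_mono1)
    ultimately have "qform g h (u, v) \<le> 4 * n" "qform g h (k, l) \<le> 4 * n" using s(4) by linarith+
    then show "s \<in> ?F \<times> ?F" unfolding s(1) by (simp del: of_nat_mult)
  qed
  show "finite (?F \<times> ?F)" by (intro finite_cartesian_product finite_qform_le assms)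
qed

lemma mem_split_quads:
  "(a, b, c, d) \<in> split_quads N n \<longleftrightarrow> a * b = int N * (c * d) \<and> (a, b, c, d) \<noteq> (0, 0, 0, 0)
     \<and> even (a + b) \<and> even (c + d) \<and> a\<^sup>2 + b\<^sup>2 + int N * c\<^sup>2 + int N * d\<^sup>2 \<le> 4 * int n"
  by (simp only: split_quads_def mem_Collect_eq prod.case)

lemma mem_split_params:
  "((u, v), (k, l)) \<in> split_params g h n \<longleftrightarrow> coprime (int g * u) (int h * v) \<and> (k, l) \<noteq> (0, 0)
      \<and> even (u * k + v * l) \<and> even (v * k + u * l) \<and> qform g h (u, v) * qform g h (k, l) \<le> 4 * n"
  by (simp only: split_params_def mem_Collect_eq prod.case)

lemma split_quads_eq_image:
  assumes N: "squarefree N" "odd N"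
  shows "split_quads N n = (\<lambda>(g, (u, v), (k, l)). (int g * u * k, int (N div g) * v * l, v * k, u * l)) `
    (SIGMA g:{g. g dvd N}. split_params g (N div g) n)" (is "_ = ?f ` ?S")
proof -
  have N0: "N > 0" using N(2) by (rule odd_pos)
  have norm: "int (qform g h (u, v) * qform g h (k, l))
      = (int g * u * k)\<^sup>2 + (int h * v * l)\<^sup>2 + int (g * h) * (v * k)\<^sup>2 + int (g * h) * (u * l)\<^sup>2"
    for g h u v k l
    unfolding of_nat_mult of_nat_qform by (simp add: power2_eq_square algebra_simps)
  have iff: "(int g * u * k, int h * v * l, v * k, u * l) \<in> split_quads N n \<longleftrightarrow> ((u, v), (k, l)) \<in> split_params g h n"
    if gh: "g * h = N" and cop: "coprime (int g * u) (int h * v)" and nz: "(k, l) \<noteq> (0, 0)" for g h u v k l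
  proof -
    have odd: "odd g" "odd h" using N(2) gh by auto
    have pos: "g > 0" "h > 0" using odd by (auto intro: odd_pos)
    have 1: "even (int g * u * k + int h * v * l) \<longleftrightarrow> even (u * k + v * l)" using odd by simp
    have 2: "(int g * u * k, int h * v * l, v * k, u * l) \<noteq> (0, 0, 0, 0)"
    proof
      assume "(int g * u * k, int h * v * l, v * k, u * l) = (0, 0, 0, 0)"
      then have "u * k = 0" "v * l = 0" "v * k = 0" "u * l = 0" using pos by simp_all
      then have "u = 0 \<and> v = 0" using nz by auto
      then show False using cop by simp
    qed
    have "int (qform g h (u, v) * qform g h (k, l)) \<le> 4 * int n
        \<longleftrightarrow> qform g h (u, v) * qform g h (k, l) \<le> 4 * n" by linarith
    then have 3: "(int g * u * k)\<^sup>2 + (int h * v * l)\<^sup>2 + int N * (v * k)\<^sup>2 + int N * (u * l)\<^sup>2 \<le> 4 * int n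
        \<longleftrightarrow> qform g h (u, v) * qform g h (k, l) \<le> 4 * n" unfolding norm gh .
    have 4: "int g * u * k * (int h * v * l) = int N * (v * k * (u * l))"
      unfolding gh[symmetric] by (simp add: algebra_simps)
    show ?thesis unfolding mem_split_quads mem_split_params using 1 2 3 4 cop nz by blast
  qed
  show ?thesis
  proof (intro equalityI subsetI)
    fix q assume q: "q \<in> split_quads N n"
    then obtain a b c d where abcd: "q = (a, b, c, d)" "a * b = int N * (c * d)" "(a, b, c, d) \<noteq> (0, 0, 0, 0)"
      unfolding split_quads_def by auto
    from split_quad_exists'[OF N(1) N0 abcd(2,3)] obtain g h u v k l where
      e: "g * h = N" "coprime (int g * u) (int h * v)" "(k, l) \<noteq> (0, 0)"
      "a = int g * u * k" "b = int h * v * l" "c = v * k" "d = u * l" by (elim exE conjE)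
    have h: "h = N div g" using e(1) N0 by auto
    have "((u, v), (k, l)) \<in> split_params g h n"
      using q iff[OF e(1-3)] unfolding abcd(1) e(4-7) by blast
    moreover have "g dvd N" using e(1) by auto
    ultimately have "(g, (u, v), (k, l)) \<in> ?S" unfolding h by simp
    moreover have "q = ?f (g, (u, v), (k, l))" unfolding abcd(1) e(4-7) h by simp
    ultimately show "q \<in> ?f ` ?S" by (rule rev_image_eqI)
  next
    fix q assume "q \<in> ?f ` ?S"
    then obtain g u v k l where q: "q = (int g * u * k, int (N div g) * v * l, v * k, u * l)"
      and g: "g dvd N" and s: "((u, v), (k, l)) \<in> split_params g (N div g) n" by auto
    have "g * (N div g) = N" using g by simp
    moreover have "coprime (int g * u) (int (N div g) * v)" "(k, l) \<noteq> (0, 0)"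
      using s unfolding split_params_def by auto
    ultimately show "q \<in> split_quads N n" using s iff unfolding q by blast
  qed
qed

text \<open>Negating u, v, k, l simultaneously fixes the quadruple, and by uniqueness nothing else
  does. The two tuples differ because u and v are not both 0, so every fibre has exactly two
  elements.\<close>

lemma sum_card_split_params:
  assumes N: "squarefree N" "odd N"
  shows "(\<Sum>g | g dvd N. card (split_params g (N div g) n)) = 2 * card (split_quads N n)"
proof -
  let ?S = "SIGMA g:{g. g dvd N}. split_params g (N div g) n"
  let ?f = "\<lambda>(g, (u, v), (k, l)). (int g * u * k, int (N div g) * v * l, v * k, u * l)"
  have N0: "N > 0" using N(2) by (rule odd_pos)
  have pos: "g > 0" "N div g > 0" if "g dvd N" for g
    using that N0 by (auto elim!: dvdE)
  have fin: "finite (split_params g (N div g) n)" if "g \<in> {g. g dvd N}" for g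
    using that by (intro finite_split_params pos) auto
  have finS: "finite ?S" using N0 fin by (intro finite_SigmaI) auto
  have fibre: "card {s \<in> ?S. ?f s = q} = 2" if q: "q \<in> ?f ` ?S" for q
  proof -
    obtain g u v k l where q: "q = ?f (g, (u, v), (k, l))" and S: "(g, (u, v), (k, l)) \<in> ?S"
      using q by auto
    let ?s = "(g, (u, v), (k, l))" and ?t = "(g, (-u, -v), (-k, -l))"
    have g: "g dvd N" "g * (N div g) = N" and cop: "coprime (int g * u) (int (N div g) * v)"
      and nz: "(k, l) \<noteq> (0, 0)" using S by (auto simp: split_params_def)
    have T: "?t \<in> ?S" using S by (auto simp: split_params_def qform_def)
    have "{s \<in> ?S. ?f s = q} = {?s, ?t}"
    proof (intro equalityI subsetI)
      fix s assume "s \<in> {s \<in> ?S. ?f s = q}"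
      then have S': "s \<in> ?S" and eq: "?f s = q" by blast+
      obtain g' p r where "s = (g', p, r)" by (cases s rule: prod_cases3)
      moreover obtain u' v' where "p = (u', v')" by (cases p)
      moreover obtain k' l' where "r = (k', l')" by (cases r)
      ultimately have s: "s = (g', (u', v'), (k', l'))" by simp
      have g': "g' * (N div g') = N" and cop': "coprime (int g' * u') (int (N div g') * v')"
        using S' unfolding s by (auto simp: split_params_def)
      have "\<exists>s\<in>{1, -1}. g' = g \<and> N div g' = N div g \<and> u' = s * u \<and> v' = s * v \<and> k' = s * k \<and> l' = s * l"
        by (rule split_quad_unique'[OF g(2) g' N0 cop cop' _ _ _ _ nz]) (use eq[unfolded s] q in simp_all)
      then show "s \<in> {?s, ?t}" unfolding s by auto
    next
      fix s assume "s \<in> {?s, ?t}"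
      then show "s \<in> {s \<in> ?S. ?f s = q}" using S T q by auto
    qed
    moreover have "?s \<noteq> ?t" using cop by auto
    ultimately show ?thesis by simp
  qed
  have "(\<Sum>g | g dvd N. card (split_params g (N div g) n)) = card ?S"
    using N0 fin by (intro card_SigmaI[symmetric]) auto
  also have "\<dots> = (\<Sum>q\<in>?f ` ?S. card {s \<in> ?S. ?f s = q})"
    using sum.image_gen[OF finS, of "\<lambda>_. 1::nat" ?f] by simp
  also have "\<dots> = (\<Sum>q\<in>?f ` ?S. 2)" using fibre by (intro sum.cong refl)
  also have "\<dots> = 2 * card (split_quads N n)"
    unfolding split_quads_eq_image[OF N] by simp
  finally show ?thesis .
qed

section \<open>Asymptotics\<close>

text \<open>With both moduli 1 the coprimality conditions are vacuous, leaving only parities.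
  Removing the origin makes all form values positive.\<close>

definition nonzero_pairs :: "bool \<Rightarrow> bool \<Rightarrow> (int \<times> int) set" where
  "nonzero_pairs b c = parity_pairs 1 1 b c - {(0, 0)}"

lemma nonzero_pairs_density:
  assumes "g > 0" "h > 0"
  shows "((\<lambda>x. real (card {z \<in> nonzero_pairs b c. real (qform g h z) \<le> x}) / x)
    \<longlongrightarrow> pi / (4 * sqrt (real g * real h))) at_top"
proof -
  let ?A = "\<lambda>x. {z \<in> parity_pairs 1 1 b c. real (qform g h z) \<le> x}"
  let ?B = "\<lambda>x. {z \<in> nonzero_pairs b c. real (qform g h z) \<le> x}"
  have d: "has_int_density (coprime_with_parity 1 b) (1 / 2)" for b
    using has_int_density_coprime_with_parity[of 1 b] by simp
  have eq: "{(u, v). u \<in> coprime_with_parity 1 b \<and> v \<in> coprime_with_parity 1 c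
      \<and> real g * (of_int u)\<^sup>2 + real h * (of_int v)\<^sup>2 \<le> x} = ?A x" for x
    by (auto simp: parity_pairs_def real_qform)
  have A: "((\<lambda>x. real (card (?A x)) / x) \<longlongrightarrow> pi / (4 * sqrt (real g * real h))) at_top"
    using lattice_points_ellipse_tendsto[of "real g" "real h", OF _ _ d[of b] d[of c], unfolded eq] assms
    by simp
  have "((\<lambda>x. real (card (?B x)) / x - real (card (?A x)) / x) \<longlongrightarrow> 0) at_top"
  proof (rule Lim_null_comparison)
    show "\<forall>\<^sub>F x in at_top. norm (real (card (?B x)) / x - real (card (?A x)) / x) \<le> 1 / x"
      using eventually_gt_at_top[of "0::real"]
    proof eventually_elim
      case (elim x)
      have fin: "finite (?A x)" by (rule finite_qform_le[OF assms])
      have B: "?B x = ?A x - {(0, 0)}" by (auto simp: nonzero_pairs_def)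
      have "card (?B x) \<le> card (?A x)" unfolding B by (intro card_mono fin) blast
      moreover have "card (?A x) - card {(0::int, 0::int)} \<le> card (?B x)"
        unfolding B by (rule diff_card_le_card_Diff) simp
      ultimately have "\<bar>real (card (?B x)) - real (card (?A x))\<bar> \<le> 1" by simp
      then have "\<bar>real (card (?B x)) - real (card (?A x))\<bar> / x \<le> 1 / x"
        using elim by (intro divide_right_mono) auto
      then show ?case using elim by (simp add: diff_divide_distrib[symmetric])
    qed
    show "((\<lambda>x::real. 1 / x) \<longlongrightarrow> 0) at_top"
      by (rule real_tendsto_divide_at_top[OF tendsto_const filterlim_ident])
  qed
  from tendsto_add[OF this A] show ?thesis by simp
qed

text \<open>The flags say whether \<open>u\<close>, \<open>v\<close>, \<open>k\<close>, \<open>l\<close> are even. All four classes contribute equally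
  to the main term.\<close>

definition param_parities :: "(bool \<times> bool \<times> bool \<times> bool) set" where
  "param_parities = {(False, False, False, False), (False, False, True, True),
     (True, False, True, True), (False, True, True, True)}"

text \<open>Coprimality forbids u and v both even. If both are odd, the parity conditions say that k
  and l have equal parity; if exactly one is odd, they force k and l to be even. This yields the
  four listed patterns.\<close>

lemma split_params_decomp:
  assumes gh: "odd g" "odd h" "coprime g h"
  shows "split_params g h n = (\<Union>(b, c, d, e)\<in>param_parities.
    {(z, w). z \<in> primitive_pairs g h b c \<and> w \<in> nonzero_pairs d e \<and> qform g h z * qform g h w \<le> 4 * n})"
    (is "_ = ?R")
proof (intro equalityI subsetI)
  have cop: "coprime (int g * u) (int h * v) \<longleftrightarrow> coprime u (int h) \<and> coprime v (int g) \<and> coprime u v" for u v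
    using gh(3) by (auto simp: coprime_commute)
  {
    fix s assume s: "s \<in> split_params g h n"
    obtain u v k l where uv: "s = ((u, v), (k, l))" by (cases s) auto
    have "(even u, even v, even k, even l) \<in> param_parities"
    proof -
      have "even (u * k + v * l)" "even (v * k + u * l)" "coprime u v"
        using s cop unfolding uv mem_split_params by blast+
      moreover have "\<not> (even u \<and> even v)"
        using coprime_common_divisor[OF \<open>coprime u v\<close>, of 2] by auto
      ultimately show ?thesis unfolding param_parities_def
        by (cases "even u"; cases "even v"; cases "even k"; cases "even l") simp_all
    qed
    moreover have "(u, v) \<in> primitive_pairs g h (even u) (even v)" "(k, l) \<in> nonzero_pairs (even k) (even l)"
      "qform g h (u, v) * qform g h (k, l) \<le> 4 * n"
      using s cop unfolding uv mem_split_params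
      by (auto simp: primitive_pairs_def parity_pairs_def coprime_with_parity_def nonzero_pairs_def)
    ultimately show "s \<in> ?R" unfolding uv by (intro UN_I) auto
  next
    fix s assume s: "s \<in> ?R"
    obtain u v k l where uv: "s = ((u, v), (k, l))" by (cases s) auto
    from s obtain b c d e where bcde: "(b, c, d, e) \<in> param_parities"
      and p: "(u, v) \<in> primitive_pairs g h b c" "(k, l) \<in> nonzero_pairs d e"
        "qform g h (u, v) * qform g h (k, l) \<le> 4 * n"
      unfolding uv by blast
    have par: "even u \<longleftrightarrow> b" "even v \<longleftrightarrow> c" "even k \<longleftrightarrow> d" "even l \<longleftrightarrow> e"
      using p by (auto simp: primitive_pairs_def parity_pairs_def coprime_with_parity_def nonzero_pairs_def)
    have "even (u * k + v * l)" "even (v * k + u * l)"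
      using bcde par unfolding param_parities_def by auto
    moreover have "coprime (int g * u) (int h * v)" "(k, l) \<noteq> (0, 0)"
      using p unfolding cop
      by (auto simp: primitive_pairs_def parity_pairs_def coprime_with_parity_def nonzero_pairs_def)
    ultimately show "s \<in> split_params g h n" unfolding uv mem_split_params using p(3) by blast
  }
qed

lemma tendsto_nat_count:
  fixes f :: "'a \<Rightarrow> nat"
  assumes "((\<lambda>x. real (card {z \<in> A. real (f z) \<le> x}) / x) \<longlongrightarrow> c) at_top"
  shows "(\<lambda>n. real (card {z \<in> A. f z \<le> n}) / real n) \<longlonglongrightarrow> c"
  using filterlim_compose[OF assms filterlim_real_sequentially] by simp

text \<open>The limit depends on \<open>g\<close> and \<open>h\<close> only through their product:
  the totients multiply, and the two ellipse areas contribute 1 / sqrt(g h) each.\<close>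

lemma card_split_params_asymp:
  assumes gh: "odd g" "odd h" "coprime g h"
  shows "(\<lambda>n. real (card (split_params g h n)) / (real n * ln (real n))) \<longlonglongrightarrow>
    pi\<^sup>2 * real (totient (g * h)) / (real (g * h))\<^sup>2
      / (pi\<^sup>2 / 6 * (\<Prod>p\<in>prime_factors (2 * (g * h)). 1 - 1 / (real p)\<^sup>2))"
proof -
  have pos: "g > 0" "h > 0" using gh by (auto intro: odd_pos)
  let ?z = "pi\<^sup>2 / 6 * (\<Prod>p\<in>prime_factors (2 * (g * h)). 1 - 1 / (real p)\<^sup>2)"
  define a where "a = (real (totient h) / real h / 2) * (real (totient g) / real g / 2) * pi / sqrt (real g * real h) / ?z"
  define b where "b = pi / (4 * sqrt (real g * real h))"
  let ?P = "\<lambda>(b, c, d, e) n. {(z, w). z \<in> primitive_pairs g h b c \<and> w \<in> nonzero_pairs d e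
    \<and> qform g h z * qform g h w \<le> n}"
  have fin: "finite {z \<in> Z. qform g h z \<le> n}" for Z n
    using finite_qform_le[OF pos, of Z "real n"] by simp
  have lim: "(\<lambda>n. real (card (?P i n)) / (real n * ln (real n))) \<longlonglongrightarrow> a * b" if "i \<in> param_parities" for i
  proof -
    obtain p q r s where i: "i = (p, q, r, s)" by (cases i rule: prod_cases4)
    have pq: "\<not> (p \<and> q)" using that unfolding i param_parities_def by auto
    show ?thesis unfolding i prod.case
    proof (rule product_count_asymp)
      show "(\<lambda>n. real (card {z \<in> primitive_pairs g h p q. qform g h z \<le> n}) / real n) \<longlonglongrightarrow> a"
        unfolding a_def by (rule tendsto_nat_count[OF primitive_pairs_density[OF gh(1,2) pq]])
      show "(\<lambda>n. real (card {z \<in> nonzero_pairs r s. qform g h z \<le> n}) / real n) \<longlonglongrightarrow> b"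
        unfolding b_def by (rule tendsto_nat_count[OF nonzero_pairs_density[OF pos]])
      show "qform g h z > 0" if "z \<in> primitive_pairs g h p q" for z
        by (rule qform_pos[OF pos primitive_pairs_nonzero[OF that]])
      show "qform g h z > 0" if "z \<in> nonzero_pairs r s" for z
        by (rule qform_pos[OF pos]) (use that in \<open>simp add: nonzero_pairs_def\<close>)
    qed (rule fin)+
  qed
  have card: "card (split_params g h n) = (\<Sum>i\<in>param_parities. card (?P i (4 * n)))" for n
  proof -
    have eq: "split_params g h n = (\<Union>i\<in>param_parities. ?P i (4 * n))"
      unfolding split_params_decomp[OF gh] by (intro SUP_cong refl) auto
    show ?thesis unfolding eq
    proof (rule card_UN_disjoint)
      show "finite param_parities" by (simp add: param_parities_def)
      have "?P i (4 * n) \<subseteq> split_params g h n" if "i \<in> param_parities" for i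
        unfolding split_params_decomp[OF gh] using that by (cases i) auto
      then show "\<forall>i\<in>param_parities. finite (?P i (4 * n))"
        using finite_subset[OF _ finite_split_params[OF pos]] by blast
      \<comment> \<open>The classes are disjoint because an element determines its four
        flags.\<close>
      have par: "(even (fst (fst s)), even (snd (fst s)), even (fst (snd s)), even (snd (snd s))) = i"
        if "s \<in> ?P i m" for s i m
      proof -
        obtain b c d e where i: "i = (b, c, d, e)" by (cases i rule: prod_cases4)
        obtain p q where pq: "s = (p, q)" by (cases s)
        obtain u v where p: "p = (u, v)" by (cases p)
        obtain k l where q: "q = (k, l)" by (cases q)
        have "(u, v) \<in> primitive_pairs g h b c" "(k, l) \<in> nonzero_pairs d e"
          using that unfolding i pq p q by simp_all
        then show ?thesis unfolding i pq p q
          by (simp add: primitive_pairs_def parity_pairs_def coprime_with_parity_def nonzero_pairs_def)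
      qed
      show "\<forall>i\<in>param_parities. \<forall>j\<in>param_parities. i \<noteq> j \<longrightarrow> ?P i (4 * n) \<inter> ?P j (4 * n) = {}"
      proof (intro ballI impI)
        fix i j :: "bool \<times> bool \<times> bool \<times> bool" assume "i \<noteq> j"
        show "?P i (4 * n) \<inter> ?P j (4 * n) = {}"
        proof (rule equals0I)
          fix s assume s: "s \<in> ?P i (4 * n) \<inter> ?P j (4 * n)"
          have 1: "s \<in> ?P i (4 * n)" using s by (rule IntD1)
          have 2: "s \<in> ?P j (4 * n)" using s by (rule IntD2)
          show False using trans[OF sym[OF par[OF 1]] par[OF 2]] \<open>i \<noteq> j\<close> by (rule notE[rotated])
        qed
      qed
    qed
  qed
  have four: "filterlim (\<lambda>n::nat. 4 * n) sequentially sequentially"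
    by (rule filterlim_subseq) (auto simp: strict_mono_def)
  \<comment> \<open>Transfers the limit from the bound 4 n to n; the term ln 4 inside ln (4 n) is
    negligible.\<close>
  have ratio: "(\<lambda>n. real (4 * n) * ln (real (4 * n)) / (real n * ln (real n))) \<longlonglongrightarrow> 4"
    by real_asymp
  have "(\<lambda>n. real (card (?P i (4 * n))) / (real (4 * n) * ln (real (4 * n)))
      * (real (4 * n) * ln (real (4 * n)) / (real n * ln (real n)))) \<longlonglongrightarrow> a * b * 4"
    if "i \<in> param_parities" for i
    by (rule tendsto_mult[OF filterlim_compose[OF lim[OF that] four] ratio])
  then have "(\<lambda>n. \<Sum>i\<in>param_parities. real (card (?P i (4 * n))) / (real (4 * n) * ln (real (4 * n)))
      * (real (4 * n) * ln (real (4 * n)) / (real n * ln (real n)))) \<longlonglongrightarrow> (\<Sum>i\<in>param_parities. a * b * 4)"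
    by (rule tendsto_sum)
  moreover have "\<forall>\<^sub>F n in sequentially. (\<Sum>i\<in>param_parities. real (card (?P i (4 * n))) / (real (4 * n) * ln (real (4 * n)))
      * (real (4 * n) * ln (real (4 * n)) / (real n * ln (real n))))
      = real (card (split_params g h n)) / (real n * ln (real n))"
    using eventually_ge_at_top[of 2]
  proof eventually_elim
    case (elim n)
    then have "real (4 * n) * ln (real (4 * n)) \<noteq> 0" by simp
    then have cancel: "x / (real (4 * n) * ln (real (4 * n))) * (real (4 * n) * ln (real (4 * n)) / y) = x / y" for x y
      by simp
    show ?case unfolding card cancel of_nat_sum sum_divide_distrib ..
  qed
  ultimately have "(\<lambda>n. real (card (split_params g h n)) / (real n * ln (real n))) \<longlonglongrightarrow>
      (\<Sum>i\<in>param_parities. a * b * 4)"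
    by (rule Lim_transform_eventually)
  moreover have "(\<Sum>i\<in>param_parities. a * b * 4) = 16 * (a * b)"
    by (simp add: param_parities_def)
  moreover have "16 * (a * b) = pi\<^sup>2 * real (totient (g * h)) / (real (g * h))\<^sup>2 / ?z"
  proof -
    have alg: "16 * ((t / y / 2) * (s / x / 2) * pi / r / z * (pi / (4 * r))) = pi\<^sup>2 * (s * t) / (x * y * (r * r)) / z"
      for r s t x y z :: real by (simp add: power2_eq_square mult_ac)
    have sq: "sqrt (real g * real h) * sqrt (real g * real h) = real g * real h" by simp
    have "16 * (a * b) = pi\<^sup>2 * (real (totient g) * real (totient h))
        / (real g * real h * (sqrt (real g * real h) * sqrt (real g * real h))) / ?z"
      unfolding a_def b_def by (rule alg)
    also have "real (totient g) * real (totient h) = real (totient (g * h))"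
      using totient_mult_coprime[OF gh(3)] by simp
    finally show ?thesis unfolding sq by (simp add: power2_eq_square)
  qed
  ultimately show ?thesis by (simp only:)
qed

section \<open>Evaluation of the constant\<close>

lemma card_divisors_prod_primes:
  fixes P :: "nat set"
  assumes "finite P" "\<And>p. p \<in> P \<Longrightarrow> prime p"
  shows "card {d. d dvd \<Prod>P} = 2 ^ card P"
  using assms
proof (induction P rule: finite_induct)
  case empty
  then show ?case by simp
next
  case (insert p P)
  let ?M = "\<Prod>P"
  have p: "prime p" using insert.prems by blast
  have P: "\<And>q. q \<in> P \<Longrightarrow> prime q" using insert.prems by blast
  have M0: "?M > 0" using P by (intro prod_pos) (auto simp: prime_gt_0_nat)
  have pM: "\<not> p dvd ?M"
  proof
    assume "p dvd ?M"
    then obtain q where "q \<in> P" "p dvd q" using p insert.hyps(1) by (auto simp: prime_dvd_prod_iff)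
    then show False using P p insert.hyps(2) primes_dvd_imp_eq by blast
  qed
  \<comment> \<open>Divisors not divisible by \<open>p\<close> already divide the old product; the
    others are \<open>p\<close> times such a divisor. So each new prime doubles the count.\<close>
  have "{d. d dvd p * ?M} = {d. d dvd ?M} \<union> (*) p ` {d. d dvd ?M}"
  proof (intro equalityI subsetI)
    fix d assume "d \<in> {d. d dvd p * ?M}"
    then have d: "d dvd p * ?M" by simp
    show "d \<in> {d. d dvd ?M} \<union> (*) p ` {d. d dvd ?M}"
    proof (cases "p dvd d")
      case True
      then obtain k where "d = p * k" by (elim dvdE)
      then show ?thesis using d prime_gt_0_nat[OF p] by auto
    next
      case False
      then have "coprime d p" using p prime_imp_coprime coprime_commute by blast
      then show ?thesis using d by (simp add: coprime_dvd_mult_right_iff)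
    qed
  qed auto
  moreover have "{d. d dvd ?M} \<inter> (*) p ` {d. d dvd ?M} = {}"
    using pM by (auto dest: dvd_mult_left)
  moreover have "finite {d. d dvd ?M}" using M0 by simp
  moreover have "card ((*) p ` {d. d dvd ?M}) = card {d. d dvd ?M}"
    using prime_gt_0_nat[OF p] by (intro card_image) (auto simp: inj_on_def)
  ultimately have "card {d. d dvd p * ?M} = 2 * card {d. d dvd ?M}"
    by (simp add: card_Un_disjoint)
  then show ?case using insert.IH P insert.hyps by simp
qed

lemma squarefree_eq_prod_prime_factors:
  fixes n :: nat
  assumes "squarefree n"
  shows "n = \<Prod>(prime_factors n)"
proof -
  have n: "n \<noteq> 0" using assms by (auto intro: ccontr)
  have "(\<Prod>p\<in>prime_factors n. p) = (\<Prod>p\<in>prime_factors n. p ^ multiplicity p n)"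
    using assms n by (intro prod.cong refl) (auto simp: squarefree_factorial_semiring' in_prime_factors_iff)
  also have "\<dots> = n" using n by (simp add: prod_prime_factors)
  finally show ?thesis by simp
qed

text \<open>For p dividing N the divisor count gives 2, the totient 1 - 1/p, and the sieve the
  divisor 1 - 1/p^2; together 2 p / (p + 1). The prime 2 turns zeta(2) into pi^2 / 8, leaving 4 / N,
  which equals 3 / N times the factor 2 * 2 / (2 + 1) = 4 / 3 for p = 2.\<close>

lemma constant_identity:
  assumes N: "squarefree N" "odd N"
  shows "real (card {g. g dvd N}) * (pi\<^sup>2 * real (totient N) / (real N)\<^sup>2
      / (pi\<^sup>2 / 6 * (\<Prod>p\<in>prime_factors (2 * N). 1 - 1 / (real p)\<^sup>2))) / 2
    = 3 / real N * (\<Prod>p\<in>{p. prime p \<and> p dvd 2 * N}. 2 * real p / (real p + 1))"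
proof -
  have N0: "N > 0" using N(2) by (rule odd_pos)
  let ?P = "prime_factors N"
  have P: "finite ?P" "\<And>p. p \<in> ?P \<Longrightarrow> prime p" by (auto simp: in_prime_factors_iff)
  have two: "2 \<notin> ?P" using N(2) by (auto simp: in_prime_factors_iff)
  have pf2: "prime_factors (2 * N) = insert 2 ?P"
    using N0 by (auto simp: in_prime_factors_iff prime_dvd_mult_iff primes_dvd_imp_eq)
  have set: "{p. prime p \<and> p dvd 2 * N} = insert 2 ?P"
    using N0 unfolding pf2[symmetric] by (auto simp: in_prime_factors_iff)
  have "card {g. g dvd N} = 2 ^ card ?P"
    using card_divisors_prod_primes[OF P] squarefree_eq_prod_prime_factors[OF N(1)] by simp
  then have d: "real (card {g. g dvd N}) = (\<Prod>p\<in>?P. 2)" by simp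
  have t: "real (totient N) = real N * (\<Prod>p\<in>?P. 1 - 1 / real p)"
    by (rule totient_formula2)
  have q: "(\<Prod>p\<in>prime_factors (2 * N). 1 - 1 / (real p)\<^sup>2) = 3 / 4 * (\<Prod>p\<in>?P. 1 - 1 / (real p)\<^sup>2)"
    unfolding pf2 using two P(1) by simp
  have r: "(\<Prod>p\<in>{p. prime p \<and> p dvd 2 * N}. 2 * real p / (real p + 1)) = 4 / 3 * (\<Prod>p\<in>?P. 2 * real p / (real p + 1))"
    unfolding set using two P(1) by simp
  have "(\<Prod>p\<in>?P. 2) * (\<Prod>p\<in>?P. 1 - 1 / real p) = (\<Prod>p\<in>?P. 2 * real p / (real p + 1)) * (\<Prod>p\<in>?P. 1 - 1 / (real p)\<^sup>2)"
    unfolding prod.distrib[symmetric]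
  proof (intro prod.cong refl)
    fix p assume "p \<in> ?P"
    then have p: "real p > 0" using P(2) prime_gt_0_nat by simp
    then have "1 - 1 / (real p)\<^sup>2 = (1 - 1 / real p) * ((real p + 1) / real p)"
      by (simp add: field_simps power2_eq_square)
    moreover have "2 * real p / (real p + 1) * (x * ((real p + 1) / real p)) = 2 * x" for x
      using p by simp
    ultimately show "2 * (1 - 1 / real p) = 2 * real p / (real p + 1) * (1 - 1 / (real p)\<^sup>2)"
      by (simp only:)
  qed
  moreover have "(\<Prod>p\<in>?P. 1 - 1 / (real p)\<^sup>2) \<noteq> 0"
  proof -
    have "1 - 1 / (real p)\<^sup>2 \<noteq> 0" if "p \<in> ?P" for p
    proof -
      have "real p > 1" using P(2)[OF that] prime_gt_1_nat by simp
      then have "(real p)\<^sup>2 > 1" by (simp add: power2_eq_square less_1_mult)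
      then show ?thesis by auto
    qed
    then show ?thesis using P(1) by simp
  qed
  ultimately have prods: "(\<Prod>p\<in>?P. 2) * (\<Prod>p\<in>?P. 1 - 1 / real p) / (\<Prod>p\<in>?P. 1 - 1 / (real p)\<^sup>2)
      = (\<Prod>p\<in>?P. 2 * real p / (real p + 1))" by simp
  have alg: "D * (pi\<^sup>2 * (real N * T) / (real N)\<^sup>2 / (pi\<^sup>2 / 6 * (3 / 4 * Q))) / 2 = 4 / real N * (D * T / Q)"
    for D T Q :: real
    using N0 by (simp add: power2_eq_square)
  show ?thesis unfolding d t q r alg prods by simp
qed

lemma sum_r2_squared_asymp:
  assumes N: "squarefree N" "odd N"
  defines "C \<equiv> 3 / real N * (\<Prod>p\<in>{p. prime p \<and> p dvd 2 * N}. 2 * real p / (real p + 1))"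
  shows "(\<lambda>n. (\<Sum>m=1..n. (real (r2 N m))\<^sup>2) / (real n * ln (real n))) \<longlonglongrightarrow> C"
proof -
  have N0: "N > 0" using N(2) by (rule odd_pos)
  let ?c = "pi\<^sup>2 * real (totient N) / (real N)\<^sup>2 / (pi\<^sup>2 / 6 * (\<Prod>p\<in>prime_factors (2 * N). 1 - 1 / (real p)\<^sup>2))"
  have "(\<lambda>n. real (card (split_params g (N div g) n)) / (real n * ln (real n))) \<longlonglongrightarrow> ?c"
    if "g \<in> {g. g dvd N}" for g
  proof -
    have eq: "g * (N div g) = N" using that by simp
    have "odd g" "odd (N div g)" using N(2) eq by (metis even_mult_iff)+
    moreover have "coprime g (N div g)" using N(1) eq squarefree_imp_coprime by metis
    ultimately show ?thesis using card_split_params_asymp[of g "N div g"] unfolding eq by blast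
  qed
  then have "(\<lambda>n. \<Sum>g | g dvd N. real (card (split_params g (N div g) n)) / (real n * ln (real n)))
      \<longlonglongrightarrow> (\<Sum>g | g dvd N. ?c)"
    by (rule tendsto_sum)
  then have "(\<lambda>n. (\<Sum>g | g dvd N. real (card (split_params g (N div g) n)) / (real n * ln (real n))) / 2)
      \<longlonglongrightarrow> (\<Sum>g | g dvd N. ?c) / 2"
    by (rule tendsto_divide) simp_all
  moreover have "(\<Sum>g | g dvd N. real (card (split_params g (N div g) n)) / (real n * ln (real n))) / 2
      = (\<Sum>m=1..n. (real (r2 N m))\<^sup>2) / (real n * ln (real n))" for n
  proof -
    have "(\<Sum>g | g dvd N. card (split_params g (N div g) n)) = 2 * (\<Sum>m=1..n. (r2 N m)\<^sup>2)"
      unfolding sum_card_split_params[OF N] card_split_quads[OF N0] sum_r2_squared[OF N0] ..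
    then have "(\<Sum>g | g dvd N. real (card (split_params g (N div g) n))) = 2 * (\<Sum>m=1..n. (real (r2 N m))\<^sup>2)"
      by (simp flip: of_nat_sum of_nat_power)
    then show ?thesis by (simp flip: sum_divide_distrib)
  qed
  moreover have "(\<Sum>g | g dvd N. ?c) / 2 = C"
    unfolding C_def constant_identity[OF N, symmetric] by simp
  ultimately show ?thesis by simp
qed

theorem theorem1p4:
  fixes N :: nat
  assumes "N > 0" and "squarefree N" and "[- int N = 1] (mod 4)"
  shows "(\<lambda>x :: real. \<Sum>n \<in> {n :: nat. 1 \<le> n \<and> real n \<le> x}. (real (r2 N n))\<^sup>2)
    \<sim>[at_top]
    (\<lambda>x :: real. 3 / real N * (\<Prod>p \<in> {p :: nat. prime p \<and> p dvd 2 * N}. 2 * real p / (real p + 1))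
       * (x * ln x))"
proof -
  let ?F = "\<lambda>x :: real. \<Sum>n \<in> {n :: nat. 1 \<le> n \<and> real n \<le> x}. (real (r2 N n))\<^sup>2"
  define C where "C = 3 / real N * (\<Prod>p \<in> {p :: nat. prime p \<and> p dvd 2 * N}. 2 * real p / (real p + 1))"
  have odd: "odd N"
  proof
    assume "even N"
    then have "even (- int N)" by simp
    moreover have "4 dvd - int N - 1" using assms(3) by (simp add: cong_iff_dvd_diff)
    then have "2 dvd - int N - 1" by (rule dvd_trans[rotated]) simp
    ultimately show False by simp
  qed
  have "(\<Prod>p \<in> {p :: nat. prime p \<and> p dvd 2 * N}. 2 * real p / (real p + 1)) > 0"
    by (intro prod_pos) (auto intro!: divide_pos_pos simp: prime_gt_0_nat)
  then have C: "C \<noteq> 0" using assms(1) by (simp add: C_def)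
  let ?m = "\<lambda>x :: real. nat \<lfloor>x\<rfloor>"
  have m_lim: "filterlim ?m sequentially at_top"
    by (rule filterlim_compose[OF filterlim_nat_sequentially filterlim_floor_sequentially])
  have "((\<lambda>x. (\<Sum>m=1..?m x. (real (r2 N m))\<^sup>2) / (real (?m x) * ln (real (?m x)))) \<longlongrightarrow> C) at_top"
    unfolding C_def by (rule filterlim_compose[OF sum_r2_squared_asymp[OF assms(2) odd] m_lim])
  \<comment> \<open>Passing from the integer cutoff, the floor of x, to x itself does not affect the
    scale x ln x.\<close>
  moreover have "((\<lambda>x. real (?m x) * ln (real (?m x)) / (x * ln x)) \<longlongrightarrow> 1) at_top"
    by real_asymp
  ultimately have "((\<lambda>x. (\<Sum>m=1..?m x. (real (r2 N m))\<^sup>2) / (real (?m x) * ln (real (?m x)))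
      * (real (?m x) * ln (real (?m x)) / (x * ln x)) / C) \<longlongrightarrow> C * 1 / C) at_top"
    by (intro tendsto_divide tendsto_mult tendsto_const C)
  moreover have "\<forall>\<^sub>F x in at_top. (\<Sum>m=1..?m x. (real (r2 N m))\<^sup>2) / (real (?m x) * ln (real (?m x)))
      * (real (?m x) * ln (real (?m x)) / (x * ln x)) / C = ?F x / (C * (x * ln x))"
    \<comment> \<open>From x = 2 on the floor is at least 2, so its logarithm is nonzero and the
      inserted factor cancels.\<close>
    using eventually_ge_at_top[of 2]
  proof eventually_elim
    case (elim x)
    have "{n :: nat. 1 \<le> n \<and> real n \<le> x} = {1..?m x}"
      using elim by (auto simp: le_nat_floor) linarith
    moreover have "real (?m x) * ln (real (?m x)) \<noteq> 0"
    proof -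
      have "?m x \<ge> 2" using elim by (simp add: le_nat_floor)
      moreover have "real k * ln (real k) \<noteq> 0" if "k \<ge> 2" for k :: nat using that by simp
      ultimately show ?thesis by blast
    qed
    moreover have "s / y * (y / t) / C = s / (C * t)" if "y \<noteq> 0" for s t y :: real
      using that by simp
    ultimately show ?case by (simp only:)
  qed
  ultimately have "((\<lambda>x. ?F x / (C * (x * ln x))) \<longlongrightarrow> C * 1 / C) at_top"
    by (rule Lim_transform_eventually)
  then have "((\<lambda>x. ?F x / (C * (x * ln x))) \<longlongrightarrow> 1) at_top" using C by simp
  then show ?thesis unfolding C_def by (rule asymp_equivI')
qed

end
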